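(* For each $I$ with $\{n\}\subseteq I\subseteq[n]$ let $e_I\in S$ be an element such that $G\text{-}\mathrm{lm}(e_I)=\{\mathrm{lm}_{\mathrm{lex}}(\tilde d_I)/d_n\}$, $\mathrm{stab}_G(e_I)=\mathrm{stab}_G(\mathrm{lm}_{\mathrm{lex}}(e_I))$, and the coefficient in $e_I$ of the monomial $\mathrm{lm}_{\mathrm{lex}}(\tilde d_I)/d_n$ is a unit of $k$. Let $V_I=kG\,e_I\subseteq S$ be the $kG$-module generated by $e_I$. Then the map $$\bigoplus_{\{n\}\subseteq I\subseteq[n]}k[d_I]\otimes_kV_I\longrightarrow S,\qquad d\otimes_kv\longmapsto dv,$$ is an isomorphism of $kG$-modules; that is, the modules $V_I$ give a structure theorem for $S$.
   Context: Let $k$ be a unital ring, not necessarily commutative, such that $ab=0$ implies $a=0$ or $b=0$ for $a,b\in k$. Fix an integer $n\ge 1$, let $[n]=\{1,\dots,n\}$, and let $S=k[x_1,\dots,x_n]$ be the polynomial ring in commuting variables with $ax_i=x_ia$ for all $a\in k$ and all $i$. Let $G=\mathrm{Sym}(x_1,\dots,x_n)$ be the symmetric group on the variables, acting on $S$ by permuting the variables (as ring automorphisms fixing $k$ pointwise). Let $d_i$ be the $i$-th elementary symmetric polynomial in $x_1,\dots,x_n$ (so $d_n=x_1\cdots x_n$). For $I\subseteq [n]$ let $k[d_I]=k[d_i\mid i\in I]\subseteq S$, which is a polynomial ring in the $d_i$, $i\in I$, and let $\tilde d_I=\prod_{i\in I}d_i$. Let $\mathrm{lm}_{\mathrm{lex}}$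 denote the leading monomial for the usual lexicographic order on monomials in $x_1,\dots,x_n$ (with $x_1>x_2>\dots>x_n$); so for $n\in I$, $\mathrm{lm}_{\mathrm{lex}}(\tilde d_I)/d_n=\prod_{i\in I\setminus\{n\}}x_1x_2\cdots x_i$. $G$ acts on $k[d_I]\otimes_k V_I$ by $g(d\otimes v)=d\otimes gv$, and $k$ acts by left multiplication. An $x$-monomial is a monomial $x_1^{r_1}\cdots x_n^{r_n}$ with $r_i\ge0$. For $x$-monomials $y,z$, let $gy$ and $hz$ ($g,h\in G$) be the lexicographically largest elements of the orbits $Gy$ and $Gz$; write $y\succcurlyeq z$ if $gy\ge_{\mathrm{lex}}hz$. For $u\in S$ let $M(u)$ be the set of $x$-monomials occurring in $u$ with non-zero coefficient, and $G\text{-}\mathrm{lm}(u)=\{x\in M(u)\mid x\succcurlyeq y\text{ for all }y\in M(u)\}$. A structure theorem for $S$ over $k[d_1,\dots,d_n]G$ is a choice of finitely generated $kG$-submodules $X_I\subseteq S$, one for each $I\subseteq[n]$, such that $\bigoplus_{I\subseteq[n]}k[d_I]\otimes_kX_I\to S$, $d\otimes x\mapsto dx$, is an isomorphism of $kG$-modules; here $X_I=V_I$ if $n\in I$ and $X_I=0$ if $n\notin I$. *)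

theory Defs
  imports
    "HOL-Algebra.Free_Abelian_Groups"
    "HOL-Algebra.Module"
    "HOL-Algebra.Sym_Groups"
    "HOL-Algebra.Generated_Rings"
begin

section \<open>Left modules over a not necessarily commutative ring\<close>

text \<open>
  The locale \<open>module\<close> of HOL-Algebra demands a commutative ring of scalars. The following has the
  same axioms over an arbitrary ring. As usual for the record \<open>module\<close>, the fields \<open>mult\<close> and
  \<open>one\<close> play no role in a module.
\<close>

locale left_module = R?: ring R + M?: abelian_group M
  for R :: "('r, 'a) ring_scheme" (structure) and M :: "('r, 'm, 'b) module_scheme" (structure) +
  assumes smult_closed:
      "\<lbrakk>a \<in> carrier R; x \<in> carrier M\<rbrakk> \<Longrightarrow> a \<odot>\<^bsub>M\<^esub> x \<in> carrier M"
    and smult_l_distr: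
      "\<lbrakk>a \<in> carrier R; b \<in> carrier R; x \<in> carrier M\<rbrakk> \<Longrightarrow>
      (a \<oplus> b) \<odot>\<^bsub>M\<^esub> x = a \<odot>\<^bsub>M\<^esub> x \<oplus>\<^bsub>M\<^esub> b \<odot>\<^bsub>M\<^esub> x"
    and smult_r_distr:
      "\<lbrakk>a \<in> carrier R; x \<in> carrier M; y \<in> carrier M\<rbrakk> \<Longrightarrow>
      a \<odot>\<^bsub>M\<^esub> (x \<oplus>\<^bsub>M\<^esub> y) = a \<odot>\<^bsub>M\<^esub> x \<oplus>\<^bsub>M\<^esub> a \<odot>\<^bsub>M\<^esub> y"
    and smult_assoc1:
      "\<lbrakk>a \<in> carrier R; b \<in> carrier R; x \<in> carrier M\<rbrakk> \<Longrightarrow>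
      (a \<otimes> b) \<odot>\<^bsub>M\<^esub> x = a \<odot>\<^bsub>M\<^esub> (b \<odot>\<^bsub>M\<^esub> x)"
    and smult_one:
      "x \<in> carrier M \<Longrightarrow> \<one> \<odot>\<^bsub>M\<^esub> x = x"

definition left_module_iso ::
  "('r, 'a) ring_scheme \<Rightarrow> ('r, 'm, 'b) module_scheme \<Rightarrow> ('r, 'n, 'c) module_scheme \<Rightarrow> ('m \<Rightarrow> 'n) \<Rightarrow> bool"
  where "left_module_iso R M N \<phi> \<longleftrightarrow>
    left_module R M \<and> left_module R N \<and> \<phi> \<in> iso (add_monoid M) (add_monoid N) \<and>
    (\<forall>r\<in>carrier R. \<forall>x\<in>carrier M. \<phi> (r \<odot>\<^bsub>M\<^esub> x) = r \<odot>\<^bsub>N\<^esub> \<phi> x)"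

definition fin_gen_submodule ::
  "('r, 'a) ring_scheme \<Rightarrow> ('r, 'm, 'b) module_scheme \<Rightarrow> 'm set \<Rightarrow> bool"
  where "fin_gen_submodule R M N \<longleftrightarrow> submodule N R M \<and>
    (\<exists>F. finite F \<and> F \<subseteq> N \<and> N = \<Inter>{H. submodule H R M \<and> F \<subseteq> H})"

definition direct_sum ::
  "'i set \<Rightarrow> ('i \<Rightarrow> ('r, 'm, 'b) module_scheme) \<Rightarrow> ('r, 'i \<Rightarrow> 'm) module"
  where "direct_sum J M = \<lparr>
    carrier = carrier (sum_group J (\<lambda>i. add_monoid (M i))),
    monoid.mult = undefined, one = undefined,
    zero = \<one>\<^bsub>sum_group J (\<lambda>i. add_monoid (M i))\<^esub>,
    add = monoid.mult (sum_group J (\<lambda>i. add_monoid (M i))),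
    smult = (\<lambda>r f. \<lambda>i\<in>J. r \<odot>\<^bsub>M i\<^esub> f i)\<rparr>"

definition group_ring :: "('g, 'a) monoid_scheme \<Rightarrow> ('g \<Rightarrow>\<^sub>0 'k::ring_1) ring"
  where "group_ring G = \<lparr>
    carrier = {r. Poly_Mapping.keys r \<subseteq> carrier G},
    monoid.mult = (\<lambda>r s. \<Sum>g\<in>Poly_Mapping.keys r. \<Sum>h\<in>Poly_Mapping.keys s.
       Poly_Mapping.single (g \<otimes>\<^bsub>G\<^esub> h) (Poly_Mapping.lookup r g * Poly_Mapping.lookup s h)),
    one = Poly_Mapping.single \<one>\<^bsub>G\<^esub> 1,
    zero = 0, add = (+)\<rparr>"


section \<open>Polynomials and the permutation action\<close>

text \<open>
  A monomial is its exponent vector, so multiplication of monomials is addition. The coefficients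
  of the convolution product of \<open>'k mpoly\<close> are multiplied in the order of the factors, and
  constants commute with variables, as required over a noncommutative \<open>'k\<close>.
  Only the variables \<open>1, \<dots>, n\<close> occur in \<open>mpolys n\<close>.
\<close>

type_synonym monom = "nat \<Rightarrow>\<^sub>0 nat"
type_synonym 'k mpoly = "(nat \<Rightarrow>\<^sub>0 nat) \<Rightarrow>\<^sub>0 'k"

definition mpolys :: "nat \<Rightarrow> 'k::ring_1 mpoly set"
  where "mpolys n = {p. \<forall>m\<in>Poly_Mapping.keys p. Poly_Mapping.keys m \<subseteq> {1..n}}"

definition Const :: "'k::ring_1 \<Rightarrow> 'k mpoly"
  where "Const c = Poly_Mapping.single 0 c"

definition perm_monom :: "(nat \<Rightarrow> nat) \<Rightarrow> monom \<Rightarrow> monom"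
  where "perm_monom g m =
    (\<Sum>i\<in>Poly_Mapping.keys m. Poly_Mapping.single (g i) (Poly_Mapping.lookup m i))"

definition perm_poly :: "(nat \<Rightarrow> nat) \<Rightarrow> 'k::ring_1 mpoly \<Rightarrow> 'k mpoly"
  where "perm_poly g p =
    (\<Sum>m\<in>Poly_Mapping.keys p. Poly_Mapping.single (perm_monom g m) (Poly_Mapping.lookup p m))"

abbreviation kG :: "nat \<Rightarrow> ((nat \<Rightarrow> nat) \<Rightarrow>\<^sub>0 'k::ring_1) ring"
  where "kG n \<equiv> group_ring (sym_group n)"

text \<open>
  The following record carries both the ring structure of \<open>S\<close> and its \<open>kG\<close>-module structure.
\<close>

definition poly_module :: "nat \<Rightarrow> ((nat \<Rightarrow> nat) \<Rightarrow>\<^sub>0 'k::ring_1, 'k mpoly) module"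
  where "poly_module n = \<lparr>
    carrier = mpolys n, monoid.mult = (*), one = 1, zero = 0, add = (+),
    smult = (\<lambda>r p. \<Sum>g\<in>Poly_Mapping.keys r. Const (Poly_Mapping.lookup r g) * perm_poly g p)\<rparr>"

definition cyclic_submodule :: "nat \<Rightarrow> 'k::ring_1 mpoly \<Rightarrow> 'k mpoly set"
  where "cyclic_submodule n e = {r \<odot>\<^bsub>poly_module n\<^esub> e | r. r \<in> carrier (kG n)}"


section \<open>Elementary symmetric polynomials\<close>

definition sqfree_monom :: "nat set \<Rightarrow> monom"
  where "sqfree_monom A = (\<Sum>i\<in>A. Poly_Mapping.single i 1)"

definition elem_sym :: "nat \<Rightarrow> nat \<Rightarrow> 'k::ring_1 mpoly"
  where "elem_sym n i =
    (\<Sum>A | A \<subseteq> {1..n} \<and> card A = i. Poly_Mapping.single (sqfree_monom A) 1)"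

definition elem_sym_subring :: "nat \<Rightarrow> nat set \<Rightarrow> 'k::ring_1 mpoly set"
  where "elem_sym_subring n I = generate_ring (poly_module n) (range Const \<union> elem_sym n ` I)"

text \<open>
  The type \<open>'k mpoly\<close> is not commutative, so the product over \<open>I\<close> is written as a list product;
  the factors are central, hence their order is irrelevant.
\<close>

definition elem_sym_prod :: "nat \<Rightarrow> nat set \<Rightarrow> 'k::ring_1 mpoly"
  where "elem_sym_prod n I = prod_list (map (elem_sym n) (sorted_list_of_set I))"


section \<open>Leading monomials\<close>

text \<open>
  The library order on finitely supported functions compares the values at the smallest argument
  where they differ. On exponent vectors this is the lexicographic order with
  \<open>x\<^sub>1 > x\<^sub>2 > \<dots>\<close>:
\<close>

lemma monom_less_iff:
  fixes y z :: monom
  shows "y < z \<longleftrightarrow> (\<exists>i. Poly_Mapping.lookup y i < Poly_Mapping.lookup z i \<and>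
    (\<forall>j<i. Poly_Mapping.lookup y j = Poly_Mapping.lookup z j))"
  by (simp add: less_poly_mapping.rep_eq less_fun_def)

definition lm_lex :: "'k::ring_1 mpoly \<Rightarrow> monom"
  where "lm_lex p = Max (Poly_Mapping.keys p)"

definition orbit_max :: "nat \<Rightarrow> monom \<Rightarrow> monom"
  where "orbit_max n y = Max ((\<lambda>g. perm_monom g y) ` carrier (sym_group n))"

definition G_lm :: "nat \<Rightarrow> 'k::ring_1 mpoly \<Rightarrow> monom set"
  where "G_lm n u =
    {x \<in> Poly_Mapping.keys u. \<forall>y\<in>Poly_Mapping.keys u. orbit_max n y \<le> orbit_max n x}"

text \<open>
  The monomial \<open>lm_lex (elem_sym_prod n I) / d\<^sub>n\<close>; for \<open>n \<in> I\<close> the division by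
  \<open>d\<^sub>n = x\<^sub>1 \<cdots> x\<^sub>n\<close> is exact. The coefficient ring has to be named, since it does not occur in
  the type of the result.
\<close>

definition top_monom :: "'k::ring_1 itself \<Rightarrow> nat \<Rightarrow> nat set \<Rightarrow> monom"
  where "top_monom _ n I = lm_lex (elem_sym_prod n I :: 'k mpoly) - sqfree_monom {1..n}"

definition stab_monom :: "nat \<Rightarrow> monom \<Rightarrow> (nat \<Rightarrow> nat) set"
  where "stab_monom n y = {g \<in> carrier (sym_group n). perm_monom g y = y}"

definition stab_poly :: "nat \<Rightarrow> 'k::ring_1 mpoly \<Rightarrow> (nat \<Rightarrow> nat) set"
  where "stab_poly n u = {g \<in> carrier (sym_group n). perm_poly g u = u}"

definition two_sided_unit :: "'k::ring_1 \<Rightarrow> bool"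
  where "two_sided_unit a \<longleftrightarrow> (\<exists>b. a * b = 1 \<and> b * a = 1)"


section \<open>Tensor products over \<open>k\<close>\<close>

text \<open>
  For a right \<open>k\<close>-submodule \<open>A\<close> and a left \<open>k\<close>-submodule \<open>B\<close> of the polynomials, the tensor
  product over \<open>k\<close> is the free abelian group on \<open>A \<times> B\<close> modulo the usual balancing relations.
\<close>

definition tensor_relations ::
  "'k::ring_1 mpoly set \<Rightarrow> 'k mpoly set \<Rightarrow> ('k mpoly \<times> 'k mpoly \<Rightarrow>\<^sub>0 int) set"
  where "tensor_relations A B =
    {frag_of (a + a', b) - frag_of (a, b) - frag_of (a', b) | a a' b. a \<in> A \<and> a' \<in> A \<and> b \<in> B} \<union>
    {frag_of (a, b + b') - frag_of (a, b) - frag_of (a, b') | a b b'. a \<in> A \<and> b \<in> B \<and> b' \<in> B} \<union>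
    {frag_of (a * Const c, b) - frag_of (a, Const c * b) | a b c. a \<in> A \<and> b \<in> B}"

definition tensor_kernel ::
  "'k::ring_1 mpoly set \<Rightarrow> 'k mpoly set \<Rightarrow> ('k mpoly \<times> 'k mpoly \<Rightarrow>\<^sub>0 int) set"
  where "tensor_kernel A B = generate (free_Abelian_group (A \<times> B)) (tensor_relations A B)"

definition tensor_class ::
  "'k::ring_1 mpoly set \<Rightarrow> 'k mpoly set \<Rightarrow>
   ('k mpoly \<times> 'k mpoly \<Rightarrow>\<^sub>0 int) \<Rightarrow> ('k mpoly \<times> 'k mpoly \<Rightarrow>\<^sub>0 int) set"
  where "tensor_class A B x = tensor_kernel A B #>\<^bsub>free_Abelian_group (A \<times> B)\<^esub> x"

definition tensor_group ::
  "'k::ring_1 mpoly set \<Rightarrow> 'k mpoly set \<Rightarrow> ('k mpoly \<times> 'k mpoly \<Rightarrow>\<^sub>0 int) set monoid"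
  where "tensor_group A B = free_Abelian_group (A \<times> B) Mod tensor_kernel A B"

abbreviation pure_tensor ::
  "'k::ring_1 mpoly set \<Rightarrow> 'k mpoly set \<Rightarrow> 'k mpoly \<Rightarrow> 'k mpoly \<Rightarrow>
   ('k mpoly \<times> 'k mpoly \<Rightarrow>\<^sub>0 int) set"
  where "pure_tensor A B a b \<equiv> tensor_class A B (frag_of (a, b))"

text \<open>
  The action of \<open>kG\<close> is given by \<open>(c g) (a \<otimes> b) = c a \<otimes> g b\<close>, first on the free abelian group
  and then on cosets through representatives; see \<open>tensor_smult_pure\<close> below.
\<close>

definition tensor_act ::
  "((nat \<Rightarrow> nat) \<Rightarrow>\<^sub>0 'k::ring_1) \<Rightarrow>
   ('k mpoly \<times> 'k mpoly \<Rightarrow>\<^sub>0 int) \<Rightarrow> ('k mpoly \<times> 'k mpoly \<Rightarrow>\<^sub>0 int)"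
  where "tensor_act r = frag_extend (\<lambda>(a, b). \<Sum>g\<in>Poly_Mapping.keys r.
    frag_of (Const (Poly_Mapping.lookup r g) * a, perm_poly g b))"

definition tensor_module ::
  "'k::ring_1 mpoly set \<Rightarrow> 'k mpoly set \<Rightarrow>
   ((nat \<Rightarrow> nat) \<Rightarrow>\<^sub>0 'k, ('k mpoly \<times> 'k mpoly \<Rightarrow>\<^sub>0 int) set) module"
  where "tensor_module A B = \<lparr>
    carrier = carrier (tensor_group A B),
    monoid.mult = undefined, one = undefined,
    zero = \<one>\<^bsub>tensor_group A B\<^esub>,
    add = monoid.mult (tensor_group A B),
    smult = (\<lambda>r T. \<Union>x\<in>T. tensor_class A B (tensor_act r x))\<rparr>"

text \<open>
  The map \<open>A \<otimes> B \<rightarrow> S\<close>, \<open>a \<otimes> b \<mapsto> a b\<close>, is evaluated on a coset by means of any representative.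
\<close>

definition eval_product :: "('k::ring_1 mpoly \<times> 'k mpoly \<Rightarrow>\<^sub>0 int) \<Rightarrow> 'k mpoly"
  where "eval_product x =
    (\<Sum>(a, b)\<in>Poly_Mapping.keys x. of_int (Poly_Mapping.lookup x (a, b)) * (a * b))"

definition mult_map :: "('k::ring_1 mpoly \<times> 'k mpoly \<Rightarrow>\<^sub>0 int) set \<Rightarrow> 'k mpoly"
  where "mult_map T = the_elem (eval_product ` T)"

text \<open>Both constructions are independent of representatives and take the expected values.\<close>

lemma eval_product_superset:
  assumes "finite K" "Poly_Mapping.keys x \<subseteq> K"
  shows "eval_product x = (\<Sum>(a, b)\<in>K. of_int (Poly_Mapping.lookup x (a, b)) * (a * b))"
  unfolding eval_product_def
  by (rule sum.mono_neutral_left) (use assms in \<open>auto simp: in_keys_iff\<close>)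

lemma eval_product_add: "eval_product (x + y) = eval_product x + eval_product y"
proof -
  let ?K = "Poly_Mapping.keys x \<union> Poly_Mapping.keys y"
  have "eval_product z = (\<Sum>(a, b)\<in>?K. of_int (Poly_Mapping.lookup z (a, b)) * (a * b))"
    if "Poly_Mapping.keys z \<subseteq> ?K" for z
    by (rule eval_product_superset) (use that in auto)
  from this[of x] this[of y] this[of "x + y"] show ?thesis
    using Poly_Mapping.keys_add[of x y]
    by (simp add: sum.distrib[symmetric] lookup_add distrib_right case_prod_unfold)
qed

lemma eval_product_0 [simp]: "eval_product 0 = 0"
  by (simp add: eval_product_def)

lemma eval_product_minus: "eval_product (- x) = - eval_product x"
  using eval_product_add[of x "- x"] by (simp add: eq_neg_iff_add_eq_0 add.commute)

lemma eval_product_diff: "eval_product (x - y) = eval_product x - eval_product y"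
  using eval_product_add[of x "- y"] by (simp add: eval_product_minus)

lemma eval_product_frag_of [simp]: "eval_product (frag_of (a, b)) = a * b"
  by (simp add: eval_product_def)

lemma tensor_relationsI:
  "a \<in> A \<Longrightarrow> a' \<in> A \<Longrightarrow> b \<in> B \<Longrightarrow>
    frag_of (a + a', b) - frag_of (a, b) - frag_of (a', b) \<in> tensor_relations A B"
  "a \<in> A \<Longrightarrow> b \<in> B \<Longrightarrow> b' \<in> B \<Longrightarrow>
    frag_of (a, b + b') - frag_of (a, b) - frag_of (a, b') \<in> tensor_relations A B"
  "a \<in> A \<Longrightarrow> b \<in> B \<Longrightarrow>
    frag_of (a * Const d, b) - frag_of (a, Const d * b) \<in> tensor_relations A B"
  unfolding tensor_relations_def by blast+

lemma tensor_relationsE: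
  assumes "h \<in> tensor_relations A B"
  obtains
      (1) a a' b where "a \<in> A" "a' \<in> A" "b \<in> B"
        "h = frag_of (a + a', b) - frag_of (a, b) - frag_of (a', b)"
    | (2) a b b' where "a \<in> A" "b \<in> B" "b' \<in> B"
        "h = frag_of (a, b + b') - frag_of (a, b) - frag_of (a, b')"
    | (3) a b d where "a \<in> A" "b \<in> B" "h = frag_of (a * Const d, b) - frag_of (a, Const d * b)"
  using assms unfolding tensor_relations_def by blast

lemma tensor_relations_subset:
  assumes A: "\<And>a a' c. a \<in> A \<Longrightarrow> a' \<in> A \<Longrightarrow> a + a' \<in> A \<and> a * Const c \<in> A"
    and B: "\<And>b b' c. b \<in> B \<Longrightarrow> b' \<in> B \<Longrightarrow> b + b' \<in> B \<and> Const c * b \<in> B"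
  shows "tensor_relations A B \<subseteq> carrier (free_Abelian_group (A \<times> B))"
proof -
  have 1: "frag_of p - frag_of q \<in> carrier (free_Abelian_group (A \<times> B))"
    if "p \<in> A \<times> B" "q \<in> A \<times> B" for p q
    using that keys_diff[of "frag_of p" "frag_of q"] by (auto simp: keys_frag_of)
  have 2: "frag_of p - frag_of q - frag_of q' \<in> carrier (free_Abelian_group (A \<times> B))"
    if "p \<in> A \<times> B" "q \<in> A \<times> B" "q' \<in> A \<times> B" for p q q'
    using 1[OF that(1,2)] that(3) keys_diff[of "frag_of p - frag_of q" "frag_of q'"]
    by (auto simp: keys_frag_of)
  show ?thesis
  proof
    fix h assume "h \<in> tensor_relations A B"
    then show "h \<in> carrier (free_Abelian_group (A \<times> B))"
      by (cases rule: tensor_relationsE; hypsubst; intro 1 2) (use A B in auto)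
  qed
qed

lemma eval_product_kernel:
  assumes "tensor_relations A B \<subseteq> carrier (free_Abelian_group (A \<times> B))"
    and "x \<in> tensor_kernel A B"
  shows "eval_product x = 0"
proof -
  have rel: "eval_product h = 0" if "h \<in> tensor_relations A B" for h
    using that
    by (cases rule: tensor_relationsE)
      (simp_all add: eval_product_diff distrib_left distrib_right mult.assoc)
  from assms(2) show ?thesis
    unfolding tensor_kernel_def
  proof (induction rule: generate.induct)
    case (incl h)
    then show ?case by (rule rel)
  next
    case (inv h)
    then show ?case using rel[of h] assms(1) by (auto simp: eval_product_minus)
  qed (auto simp: eval_product_add)
qed

lemma mult_map_class:
  assumes "tensor_relations A B \<subseteq> carrier (free_Abelian_group (A \<times> B))"
  shows "mult_map (tensor_class A B x) = eval_product x"
proof -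
  have "0 \<in> tensor_kernel A B"
    using generate.one[of "free_Abelian_group (A \<times> B)"] by (simp add: tensor_kernel_def)
  then have "eval_product ` tensor_class A B x = {eval_product x}"
    using eval_product_kernel[OF assms]
    by (force simp: tensor_class_def r_coset_def eval_product_add)
  then show ?thesis by (simp add: mult_map_def)
qed

lemma mult_map_pure:
  assumes "tensor_relations A B \<subseteq> carrier (free_Abelian_group (A \<times> B))"
  shows "mult_map (pure_tensor A B a b) = a * b"
  using assms by (simp add: mult_map_class)

lemma tensor_act_add: "tensor_act r (x + y) = tensor_act r x + tensor_act r y"
  by (simp add: tensor_act_def frag_extend_add)

lemma tensor_act_diff: "tensor_act r (x - y) = tensor_act r x - tensor_act r y"
  by (simp add: tensor_act_def frag_extend_diff)

lemma tensor_act_minus: "tensor_act r (- x) = - tensor_act r x"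
  by (simp add: tensor_act_def frag_extend_minus)

lemma perm_poly_superset:
  assumes "finite K" "Poly_Mapping.keys p \<subseteq> K"
  shows "perm_poly g p = (\<Sum>m\<in>K. Poly_Mapping.single (perm_monom g m) (Poly_Mapping.lookup p m))"
  unfolding perm_poly_def
  by (rule sum.mono_neutral_left) (use assms in \<open>auto simp: in_keys_iff\<close>)

lemma perm_poly_add: "perm_poly g (p + q) = perm_poly g p + perm_poly g q"
proof -
  let ?K = "Poly_Mapping.keys p \<union> Poly_Mapping.keys q"
  have "perm_poly g z = (\<Sum>m\<in>?K. Poly_Mapping.single (perm_monom g m) (Poly_Mapping.lookup z m))"
    if "Poly_Mapping.keys z \<subseteq> ?K" for z
    by (rule perm_poly_superset) (use that in auto)
  from this[of p] this[of q] this[of "p + q"] show ?thesis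
    using Poly_Mapping.keys_add[of p q]
    by (simp add: sum.distrib[symmetric] lookup_add single_add)
qed

lemma lookup_Const_mult: "Poly_Mapping.lookup (Const c * p) m = c * Poly_Mapping.lookup p m"
proof -
  have "Const c * p = Poly_Mapping.map ((*) c) p"
    unfolding Const_def by (rule mult_map_scale_conv_mult[symmetric])
  then show ?thesis by (simp add: map.rep_eq when_def)
qed

lemma perm_poly_Const_mult: "perm_poly g (Const c * p) = Const c * perm_poly g p"
proof -
  have "Poly_Mapping.keys (Const c * p) \<subseteq> Poly_Mapping.keys p"
    by (auto simp: in_keys_iff lookup_Const_mult)
  then show ?thesis
    by (simp add: perm_poly_superset[of "Poly_Mapping.keys p"] perm_poly_def[of g p]
        lookup_Const_mult[unfolded Const_def] sum_distrib_left Const_def mult_single)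
qed

lemma tensor_act_kernel:
  assumes sub: "tensor_relations A B \<subseteq> carrier (free_Abelian_group (A \<times> B))"
    and A: "\<And>a c. a \<in> A \<Longrightarrow> Const c * a \<in> A"
    and B: "\<And>b g. b \<in> B \<Longrightarrow> g \<in> Poly_Mapping.keys r \<Longrightarrow> perm_poly g b \<in> B"
    and x: "x \<in> tensor_kernel A B"
  shows "tensor_act r x \<in> tensor_kernel A B"
proof -
  interpret F: group "free_Abelian_group (A \<times> B)" by simp
  interpret K: subgroup "tensor_kernel A B" "free_Abelian_group (A \<times> B)"
    unfolding tensor_kernel_def by (rule F.generate_is_subgroup[OF sub])
  have K_sum: "(\<Sum>g\<in>J. f g) \<in> tensor_kernel A B"
    if "finite J" "\<And>g. g \<in> J \<Longrightarrow> f g \<in> tensor_kernel A B" for f :: "(nat \<Rightarrow> nat) \<Rightarrow> _" and J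
    using that
  proof (induction rule: finite_induct)
    case empty then show ?case using K.one_closed by simp
  next
    case (insert g J)
    then show ?case using K.m_closed[of "f g" "sum f J"] by simp
  qed
  have rel: "tensor_act r h \<in> tensor_kernel A B" if h: "h \<in> tensor_relations A B" for h
  proof -
    define c where "c = (\<lambda>g. Const (Poly_Mapping.lookup r g))"
    have act: "tensor_act r (frag_of (a, b)) =
        (\<Sum>g\<in>Poly_Mapping.keys r. frag_of (c g * a, perm_poly g b))" for a b
      by (simp add: tensor_act_def c_def)
    have incl: "y \<in> tensor_relations A B \<Longrightarrow> y \<in> tensor_kernel A B" for y
      unfolding tensor_kernel_def by (rule generate.incl)
    from h show ?thesis
    proof (cases rule: tensor_relationsE)
      case (1 a a' b)
      have "tensor_act r h = (\<Sum>g\<in>Poly_Mapping.keys r. frag_of (c g * a + c g * a', perm_poly g b)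
          - frag_of (c g * a, perm_poly g b) - frag_of (c g * a', perm_poly g b))"
        by (simp add: 1 tensor_act_diff act sum_subtractf distrib_left)
      also have "\<dots> \<in> tensor_kernel A B"
        using 1 A B by (intro K_sum incl tensor_relationsI) (auto simp: c_def)
      finally show ?thesis .
    next
      case (2 a b b')
      have "tensor_act r h = (\<Sum>g\<in>Poly_Mapping.keys r. frag_of (c g * a, perm_poly g b + perm_poly g b')
          - frag_of (c g * a, perm_poly g b) - frag_of (c g * a, perm_poly g b'))"
        by (simp add: 2 tensor_act_diff act sum_subtractf perm_poly_add)
      also have "\<dots> \<in> tensor_kernel A B"
        using 2 A B by (intro K_sum incl tensor_relationsI) (auto simp: c_def)
      finally show ?thesis .
    next
      case (3 a b d)
      have "tensor_act r h = (\<Sum>g\<in>Poly_Mapping.keys r. frag_of ((c g * a) * Const d, perm_poly g b)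
          - frag_of (c g * a, Const d * perm_poly g b))"
        by (simp add: 3 tensor_act_diff act sum_subtractf
            perm_poly_Const_mult mult.assoc)
      also have "\<dots> \<in> tensor_kernel A B"
        using 3 A B by (intro K_sum incl tensor_relationsI) (auto simp: c_def)
      finally show ?thesis .
    qed
  qed
  from x show ?thesis
    unfolding tensor_kernel_def
  proof (induction rule: generate.induct)
    case one
    then show ?case using K.one_closed by (simp add: tensor_act_def tensor_kernel_def)
  next
    case (incl h)
    then show ?case using rel by (simp add: tensor_kernel_def)
  next
    case (inv h)
    then show ?case
      using rel[of h] sub K.m_inv_closed[of "tensor_act r h"] K.subset
      by (auto simp: tensor_kernel_def tensor_act_minus subset_iff)
  next
    case (eng h1 h2)
    then show ?case using K.m_closed by (simp add: tensor_kernel_def tensor_act_add)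
  qed
qed

lemma tensor_smult_class:
  assumes sub: "tensor_relations A B \<subseteq> carrier (free_Abelian_group (A \<times> B))"
    and A: "\<And>a c. a \<in> A \<Longrightarrow> Const c * a \<in> A"
    and B: "\<And>b g. b \<in> B \<Longrightarrow> g \<in> Poly_Mapping.keys r \<Longrightarrow> perm_poly g b \<in> B"
  shows "r \<odot>\<^bsub>tensor_module A B\<^esub> tensor_class A B x = tensor_class A B (tensor_act r x)"
proof -
  interpret F: group "free_Abelian_group (A \<times> B)" by simp
  interpret K: subgroup "tensor_kernel A B" "free_Abelian_group (A \<times> B)"
    unfolding tensor_kernel_def by (rule F.generate_is_subgroup[OF sub])
  have shift: "tensor_class A B (k + y) = tensor_class A B y" if k: "k \<in> tensor_kernel A B" for k y
  proof -
    have "inv\<^bsub>free_Abelian_group (A \<times> B)\<^esub> k = - k" "- k \<in> tensor_kernel A B"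
      using K.m_inv_closed[OF k] subsetD[OF K.subset k] by simp_all
    then have diff: "h - k \<in> tensor_kernel A B" if "h \<in> tensor_kernel A B" for h
      using K.m_closed[OF that, of "- k"] by simp
    have add: "h + k \<in> tensor_kernel A B" if "h \<in> tensor_kernel A B" for h
      using K.m_closed[OF that k] by simp
    have coset: "tensor_class A B z = (\<lambda>h. h + z) ` tensor_kernel A B" for z
      by (auto simp: tensor_class_def r_coset_def)
    show ?thesis
      unfolding coset
    proof (intro equalityI image_subsetI)
      fix h assume "h \<in> tensor_kernel A B"
      from add[OF this] show "h + (k + y) \<in> (\<lambda>h. h + y) ` tensor_kernel A B"
        by (intro image_eqI[of _ _ "h + k"]) (simp_all add: add.assoc)
    next
      fix h assume "h \<in> tensor_kernel A B"
      from diff[OF this] show "h + y \<in> (\<lambda>h. h + (k + y)) ` tensor_kernel A B"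
        by (intro image_eqI[of _ _ "h - k"]) simp_all
    qed
  qed
  have "r \<odot>\<^bsub>tensor_module A B\<^esub> tensor_class A B x =
      (\<Union>h\<in>tensor_kernel A B. tensor_class A B (tensor_act r h + tensor_act r x))"
    by (auto simp: tensor_module_def tensor_class_def[of A B x] r_coset_def tensor_act_add)
  also have "\<dots> = (\<Union>h\<in>tensor_kernel A B. tensor_class A B (tensor_act r x))"
    using tensor_act_kernel[OF sub A B] by (simp add: shift)
  also have "\<dots> = tensor_class A B (tensor_act r x)"
    using K.one_closed by auto
  finally show ?thesis .
qed

lemma tensor_smult_pure:
  assumes "tensor_relations A B \<subseteq> carrier (free_Abelian_group (A \<times> B))"
    and "\<And>a c. a \<in> A \<Longrightarrow> Const c * a \<in> A"
    and "\<And>b. b \<in> B \<Longrightarrow> perm_poly g b \<in> B" and "c \<noteq> 0"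
  shows "Poly_Mapping.single g c \<odot>\<^bsub>tensor_module A B\<^esub> pure_tensor A B a b =
    pure_tensor A B (Const c * a) (perm_poly g b)"
  using assms by (subst tensor_smult_class) (auto simp: tensor_act_def)


section \<open>Structure theorems\<close>

definition struct_sum ::
  "nat \<Rightarrow> nat set set \<Rightarrow> (nat set \<Rightarrow> 'k::ring_1 mpoly set) \<Rightarrow>
   ((nat \<Rightarrow> nat) \<Rightarrow>\<^sub>0 'k, nat set \<Rightarrow> ('k mpoly \<times> 'k mpoly \<Rightarrow>\<^sub>0 int) set) module"
  where "struct_sum n J X = direct_sum J (\<lambda>I. tensor_module (elem_sym_subring n I) (X I))"

definition struct_map ::
  "nat set set \<Rightarrow> (nat set \<Rightarrow> ('k::ring_1 mpoly \<times> 'k mpoly \<Rightarrow>\<^sub>0 int) set) \<Rightarrow> 'k mpoly"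
  where "struct_map J f = (\<Sum>I\<in>J. mult_map (f I))"

definition structure_theorem :: "nat \<Rightarrow> (nat set \<Rightarrow> 'k::ring_1 mpoly set) \<Rightarrow> bool"
  where "structure_theorem n X \<longleftrightarrow>
    (\<forall>I. I \<subseteq> {1..n} \<longrightarrow> fin_gen_submodule (kG n) (poly_module n) (X I)) \<and>
    left_module_iso (kG n) (struct_sum n (Pow {1..n}) X) (poly_module n) (struct_map (Pow {1..n}))"

end

theory Submission
  imports Defs
begin

text \<open>
  Every monomial is \<open>g \<lambda>\<close> for a unique weakly decreasing \<open>\<lambda>\<close>, and \<open>\<lambda>\<close> is the leading monomial of
  \<open>d\<^sub>1^c\<^sub>1 \<cdots> d\<^sub>n^c\<^sub>n\<close> for unique exponents \<open>c\<close>. With \<open>I = {i. c\<^sub>i \<noteq> 0} \<union> {n}\<close> this leading monomial is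
  the product of the leading monomials of some \<open>d \<in> k[d\<^sub>I]\<close>, a product of powers of the \<open>d\<^sub>i\<close>, and
  of \<open>e\<^sub>I\<close>. The stabiliser of \<open>\<lambda>\<close> equals that of the leading monomial of \<open>e\<^sub>I\<close>, which fixes \<open>e\<^sub>I\<close>
  by assumption; hence \<open>d \<cdot> g e\<^sub>I\<close> depends only on \<open>g \<lambda>\<close>. It contains \<open>g \<lambda>\<close> with a unit as
  coefficient, and all of its other monomials lie in lexicographically smaller orbits. By triangularity
  and well-foundedness these products form a \<open>k\<close>-basis of \<open>S\<close>. Since the tensors \<open>d \<otimes> g e\<^sub>I\<close> span the
  direct sum over \<open>k\<close>, the multiplication map is bijective.
\<close>

text \<open>The obstacle is that \<open>orbit_max\<close> is not additive: a permutation may raise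
  one summand of a sum of monomials and lower the other, so the leading orbits of two factors need
  not determine that of their product. Two facts remove it. The factor d is symmetric, so its set of
  monomials is stable under permutations; and a permutation fixing the leading monomial of
  \<open>e I\<close> preserves every segment \<open>{1..i}\<close> with i in I, hence also fixes the
  leading monomial of d. The index n comes for free, because every permutation preserves
  \<open>{1..n}\<close>; this is why I can always be enlarged by n, and why d_n is divided out of
  the leading monomial of \<open>e I\<close>. Linear independence is proved in S alone and pulled
  back to the tensors. Even the module axioms of the direct sum are pulled back along the
  multiplication map.\<close>

abbreviation "keys \<equiv> Poly_Mapping.keys"
abbreviation "lookup \<equiv> Poly_Mapping.lookup"
abbreviation "single \<equiv> Poly_Mapping.single"

section \<open>The permutation action on monomials\<close>

lemma perm_monom_superset:
  assumes "finite K" "keys m \<subseteq> K"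
  shows "perm_monom g m = (\<Sum>i\<in>K. single (g i) (lookup m i))"
  unfolding perm_monom_def
  by (rule sum.mono_neutral_left) (use assms in \<open>auto simp: in_keys_iff\<close>)

lemma perm_monom_0 [simp]: "perm_monom g 0 = 0"
  by (simp add: perm_monom_def)

text \<open>The sums for \<open>p\<close>, \<open>q\<close> and \<open>p + q\<close> run over
  different supports; \<open>perm_monom_superset\<close> puts them over one finite set, where they
  add termwise. The same device gives the additivity of \<open>poly_act\<close>,
  \<open>expand\<close> and \<open>elem_sym_poly\<close>.\<close>

lemma perm_monom_add: "perm_monom g (p + q) = perm_monom g p + perm_monom g q"
proof -
  let ?K = "keys p \<union> keys q"
  have "perm_monom g z = (\<Sum>m\<in>?K. single (g m) (lookup z m))"
    if "keys z \<subseteq> ?K" for z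
    by (rule perm_monom_superset) (use that in auto)
  from this[of p] this[of q] this[of "p + q"] show ?thesis
    using Poly_Mapping.keys_add[of p q]
    by (simp add: sum.distrib[symmetric] lookup_add single_add)
qed

lemma perm_monom_sum: "perm_monom g (\<Sum>i\<in>I. f i) = (\<Sum>i\<in>I. perm_monom g (f i))"
  by (induction I rule: infinite_finite_induct) (auto simp: perm_monom_add)

lemma perm_monom_single [simp]: "perm_monom g (single i k) = single (g i) k"
  by (cases "k = 0") (simp_all add: perm_monom_def)

lemma lookup_perm_monom:
  assumes "bij g"
  shows "lookup (perm_monom g m) i = lookup m (inv' g i)"
proof -
  have "lookup (perm_monom g m) i = (\<Sum>j\<in>keys m. lookup m j when g j = i)"
    by (simp add: perm_monom_def lookup_sum lookup_single)
  also have "\<dots> = (\<Sum>j\<in>keys m. lookup m j when j = inv' g i)"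
    using assms by (intro sum.cong) (auto simp: bij_inv_eq_iff when_def)
  also have "\<dots> = lookup m (inv' g i)"
    by (simp add: when_def in_keys_iff)
  finally show ?thesis .
qed

lemma perm_monom_id [simp]: "perm_monom id m = m"
  by (rule poly_mapping_eqI) (simp add: lookup_perm_monom)

lemma perm_monom_comp:
  assumes "bij g" "bij h"
  shows "perm_monom (g \<circ> h) m = perm_monom g (perm_monom h m)"
  by (rule poly_mapping_eqI)
    (simp add: lookup_perm_monom bij_comp assms o_inv_distrib bij_is_inj bij_is_surj)

lemma perm_monom_inv:
  assumes "bij g"
  shows "perm_monom (inv' g) (perm_monom g m) = m" "perm_monom g (perm_monom (inv' g) m) = m"
proof -
  have *: "inv' g \<circ> g = id" "g \<circ> inv' g = id"
    using assms by (auto simp: fun_eq_iff bij_is_inj bij_is_surj surj_f_inv_f)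
  have b: "bij (inv' g)" using assms by (rule bij_imp_bij_inv)
  show "perm_monom (inv' g) (perm_monom g m) = m"
    using perm_monom_comp[OF b assms, of m] by (simp only: * perm_monom_id)
  show "perm_monom g (perm_monom (inv' g) m) = m"
    using perm_monom_comp[OF assms b, of m] by (simp only: * perm_monom_id)
qed

lemma perm_monom_inj_iff [simp]:
  assumes "bij g"
  shows "perm_monom g m = perm_monom g m' \<longleftrightarrow> m = m'"
proof
  assume "perm_monom g m = perm_monom g m'"
  then have "perm_monom (inv' g) (perm_monom g m) = perm_monom (inv' g) (perm_monom g m')"
    by (rule arg_cong)
  then show "m = m'" by (simp only: perm_monom_inv[OF assms])
qed simp

lemma keys_perm_monom:
  assumes "bij g"
  shows "keys (perm_monom g m) = g ` keys m"
proof -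
  have "i \<in> keys (perm_monom g m) \<longleftrightarrow> inv' g i \<in> keys m" for i
    by (simp add: in_keys_iff lookup_perm_monom[OF assms])
  then show ?thesis
    using bij_image_Collect_eq[OF assms, of "\<lambda>i. i \<in> keys m"] by auto
qed

definition monoms :: "nat \<Rightarrow> monom set"
  where "monoms n = {m. keys m \<subseteq> {1..n}}"

lemma mpolys_iff: "p \<in> mpolys n \<longleftrightarrow> keys p \<subseteq> monoms n"
  by (auto simp: mpolys_def monoms_def)

lemma monoms_add: "m \<in> monoms n \<Longrightarrow> m' \<in> monoms n \<Longrightarrow> m + m' \<in> monoms n"
  using Poly_Mapping.keys_add[of m m'] by (auto simp: monoms_def)

lemma perm_monom_in_monoms:
  "g permutes {1..n} \<Longrightarrow> m \<in> monoms n \<Longrightarrow> perm_monom g m \<in> monoms n"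
  using permutes_image[of g "{1..n}"]
  by (auto simp: monoms_def keys_perm_monom permutes_bij)

section \<open>Orbits\<close>

lemma carrier_sym_group [simp]: "carrier (sym_group n) = {g. g permutes {1..n}}"
  by (simp add: sym_group_def)

lemma finite_orbit: "finite ((\<lambda>g. perm_monom g m) ` carrier (sym_group n))"
  by (simp add: finite_permutations)

lemma orbit_max_ge: "g permutes {1..n} \<Longrightarrow> perm_monom g m \<le> orbit_max n m"
  unfolding orbit_max_def by (rule Max_ge[OF finite_orbit]) simp

lemma le_orbit_max: "m \<le> orbit_max n m"
  using orbit_max_ge[OF permutes_id, of m n] by simp

lemma orbit_max_attained:
  obtains g where "g permutes {1..n}" "orbit_max n m = perm_monom g m"
proof -
  have "orbit_max n m \<in> (\<lambda>g. perm_monom g m) ` carrier (sym_group n)"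
    unfolding orbit_max_def
    by (rule Max_in[OF finite_orbit]) (auto intro: permutes_id)
  then show thesis using that by auto
qed

lemma orbit_max_eqI:
  assumes "g permutes {1..n}" "\<And>h. h permutes {1..n} \<Longrightarrow> perm_monom h m \<le> perm_monom g m"
  shows "orbit_max n m = perm_monom g m"
  using assms orbit_max_attained[of n m] orbit_max_ge by (metis antisym)

lemma orbit_max_perm [simp]:
  assumes g: "g permutes {1..n}"
  shows "orbit_max n (perm_monom g m) = orbit_max n m"
proof -
  obtain h where h: "h permutes {1..n}" "orbit_max n m = perm_monom h m"
    by (rule orbit_max_attained)
  have b: "bij g" "bij h" "bij (inv' g)" using g h permutes_bij bij_imp_bij_inv by blast+
  have "orbit_max n (perm_monom g m) = perm_monom (h \<circ> inv' g) (perm_monom g m)"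
  proof (rule orbit_max_eqI)
    show "h \<circ> inv' g permutes {1..n}"
      by (intro permutes_compose permutes_inv g h)
    fix k assume k: "k permutes {1..n}"
    have "perm_monom k (perm_monom g m) = perm_monom (k \<circ> g) m"
      using k by (simp add: perm_monom_comp b permutes_bij)
    also have "\<dots> \<le> orbit_max n m" by (intro orbit_max_ge permutes_compose g k)
    finally show "perm_monom k (perm_monom g m) \<le> perm_monom (h \<circ> inv' g) (perm_monom g m)"
      by (simp add: h perm_monom_comp b perm_monom_inv)
  qed
  then show ?thesis by (simp add: h perm_monom_comp b perm_monom_inv)
qed

lemma orbit_max_in_monoms: "m \<in> monoms n \<Longrightarrow> orbit_max n m \<in> monoms n"
  by (rule orbit_max_attained[of n m]) (simp add: perm_monom_in_monoms)

text \<open>With infinitely many variables the order has descending chains such as x_1 > x_2 > x_3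
  and so on. On n variables it embeds into the lexicographic order on lists of a fixed
  length.\<close>

lemma wf_monoms: "wf {(m, m'). m \<in> monoms n \<and> m' \<in> monoms n \<and> m < m'}"
proof -
  \<comment> \<open>Position 0, where all exponents vanish, is included so that list positions and
    variable indices agree.\<close>
  let ?f = "\<lambda>m. map (lookup m) [0..<Suc n]"
  have "{(m, m'). m \<in> monoms n \<and> m' \<in> monoms n \<and> m < m'} \<subseteq> inv_image (lexn less_than (Suc n)) ?f"
  proof clarify
    fix m m' assume *: "m \<in> monoms n" "m' \<in> monoms n" "m < m'"
    then obtain i where i: "lookup m i < lookup m' i" "\<And>j. j < i \<Longrightarrow> lookup m j = lookup m' j"
      by (auto simp: monom_less_iff)
    have "i \<in> keys m'" using i by (auto simp: in_keys_iff)
    then have "i \<le> n" using * by (auto simp: monoms_def)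
    then have split: "[0..<Suc n] = [0..<i] @ i # [Suc i..<Suc n]"
      using upt_add_eq_append[of 0 i "Suc n - i"] by (simp add: upt_conv_Cons)
    show "(m, m') \<in> inv_image (lexn less_than (Suc n)) ?f"
      unfolding in_inv_image lexn_conv
    proof (simp del: upt_Suc, intro exI conjI)
      show "?f m = map (lookup m) [0..<i] @ lookup m i # map (lookup m) [Suc i..<Suc n]"
        by (simp only: split map_append list.map)
      show "?f m' = map (lookup m) [0..<i] @ lookup m' i # map (lookup m') [Suc i..<Suc n]"
        using i(2) by (simp only: split map_append list.map) simp
      show "lookup m i < lookup m' i" by fact
    qed
  qed
  then show ?thesis
    by (rule wf_subset[rotated]) (intro wf_inv_image wf_lexn wf_less_than)
qed

section \<open>Dominant monomials\<close>

text \<open>\<open>stairs n c\<close> is the leading monomial of \<open>d\<^sub>1^c\<^sub>1 \<cdots> d\<^sub>n^c\<^sub>n\<close>.\<close>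

definition stairs :: "nat \<Rightarrow> monom \<Rightarrow> monom"
  where "stairs n c = (\<Sum>i=1..n. \<Sum>j=1..i. single j (lookup c i))"

lemma lookup_flat:
  "finite A \<Longrightarrow> lookup (\<Sum>j\<in>A. single j k) i = (if i \<in> A then k else 0)"
  by (simp add: lookup_sum lookup_single when_def)

lemma flat_inj:
  assumes "finite A" "finite B" "k \<noteq> (0::nat)"
    and "(\<Sum>j\<in>A. single j k) = (\<Sum>j\<in>B. single j k)"
  shows "A = B"
proof -
  have "lookup (\<Sum>j\<in>A. single j k) i = lookup (\<Sum>j\<in>B. single j k) i" for i
    using assms by simp
  then have "i \<in> A \<longleftrightarrow> i \<in> B" for i
    using assms(1-3) by (metis lookup_flat)
  then show ?thesis by blast
qed

text \<open>The two sides first differ at the least element of \<open>{1..i}\<close> missing from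
  \<open>A\<close>, where the right side is larger. By cardinality such an element exists unless
  \<open>A = {1..i}\<close>.\<close>

lemma flat_le:
  fixes k :: nat
  assumes A: "A \<subseteq> {1..n}" "card A = i"
  shows "(\<Sum>j\<in>A. single j k) \<le> (\<Sum>j=1..i. single j k)"
proof (cases "A = {1..i} \<or> k = 0")
  case False
  have fin: "finite A" using A finite_subset by blast
  have "\<not> {1..i} \<subseteq> A"
    using False A card_subset_eq[of A "{1..i}"] fin by auto
  then have ex: "\<exists>j. j \<in> {1..i} \<and> j \<notin> A" by blast
  define j where "j = (LEAST j. j \<in> {1..i} \<and> j \<notin> A)"
  have j: "j \<in> {1..i}" "j \<notin> A" using LeastI_ex[OF ex] by (auto simp: j_def)
  have "j' \<in> A \<longleftrightarrow> j' \<in> {1..i}" if "j' < j" for j'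
    using not_less_Least[of j' "\<lambda>j. j \<in> {1..i} \<and> j \<notin> A", folded j_def] that j A by auto
  then have "(\<Sum>j\<in>A. single j k) < (\<Sum>j=1..i. single j k)"
    unfolding monom_less_iff using j fin False
    by (intro exI[of _ j]) (simp add: lookup_flat)
  then show ?thesis by simp
qed auto

lemma perm_flat:
  assumes "inj_on g A"
  shows "perm_monom g (\<Sum>j\<in>A. single j k) = (\<Sum>j\<in>g ` A. single j k)"
  using assms by (simp add: perm_monom_sum sum.reindex)

lemma perm_flat_le:
  assumes g: "g permutes {1..n}" and "i \<in> {1..n}"
  shows "perm_monom g (\<Sum>j=1..i. single j k) \<le> (\<Sum>j=1..i. single j k)"
proof -
  have inj: "inj_on g {1..i}" using g by (meson permutes_inj_on)
  moreover have "g ` {1..i} \<subseteq> {1..n}"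
    using permutes_image[OF g] assms(2) by (metis atLeastAtMost_iff atLeastatMost_subset_iff image_mono le_refl)
  ultimately show ?thesis
    using flat_le[of "g ` {1..i}" n i k] by (simp add: perm_flat card_image)
qed

lemma perm_flat_eq_iff:
  assumes "g permutes {1..n}"
  shows "perm_monom g (\<Sum>j=1..i. single j k) = (\<Sum>j=1..i. single j k) \<longleftrightarrow> k = 0 \<or> g ` {1..i} = {1..i}"
  using assms flat_inj[of "g ` {1..i}" "{1..i}" k]
  by (auto simp: perm_flat permutes_inj_on)

lemma stairs_add: "stairs n (a + b) = stairs n a + stairs n b"
  by (simp add: stairs_def lookup_add single_add sum.distrib)

lemma stairs_0 [simp]: "stairs n 0 = 0"
  by (simp add: stairs_def)

lemma stairs_single:
  assumes "i \<in> {1..n}"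
  shows "stairs n (single i k) = (\<Sum>j=1..i. single j k)"
proof -
  have "stairs n (single i k) = (\<Sum>i'=1..n. if i' = i then (\<Sum>j=1..i. single j k) else 0)"
    unfolding stairs_def by (intro sum.cong) (auto simp: lookup_single)
  then show ?thesis using assms by simp
qed

lemma lookup_stairs: "j \<ge> 1 \<Longrightarrow> lookup (stairs n c) j = (\<Sum>i=j..n. lookup c i)"
proof -
  assume "j \<ge> 1"
  have "lookup (stairs n c) j = (\<Sum>i=1..n. if j \<le> i then lookup c i else 0)"
    using \<open>j \<ge> 1\<close> unfolding stairs_def lookup_sum[of _ "{1..n}"]
    by (intro sum.cong) (simp_all add: lookup_flat)
  also have "\<dots> = (\<Sum>i\<in>{i\<in>{1..n}. j \<le> i}. lookup c i)"
    by (rule sum.inter_filter[symmetric]) simp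
  also have "{i\<in>{1..n}. j \<le> i} = {j..n}" using \<open>j \<ge> 1\<close> by auto
  finally show ?thesis .
qed

lemma stairs_in_monoms: "stairs n c \<in> monoms n"
proof -
  have "lookup (stairs n c) j = 0" if "j \<notin> {1..n}" for j
    using that unfolding stairs_def lookup_sum[of _ "{1..n}"]
    by (intro sum.neutral) (auto simp: lookup_flat)
  then have "j \<in> {1..n}" if "j \<in> keys (stairs n c)" for j
    using that unfolding in_keys_iff by metis
  then show ?thesis unfolding monoms_def by blast
qed

text \<open>The vector \<open>c\<close> is recovered as the successive differences of the exponents
  of \<open>stairs n c\<close>.\<close>

lemma stairs_inj:
  assumes "c \<in> monoms n" "c' \<in> monoms n" "stairs n c = stairs n c'"
  shows "c = c'"
proof (rule poly_mapping_eqI)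
  fix i
  show "lookup c i = lookup c' i"
  proof (cases "i \<in> {1..n}")
    case True
    have "lookup (stairs n d) i = lookup d i + lookup (stairs n d) (Suc i)" for d
      using True by (simp add: lookup_stairs sum.atLeast_Suc_atMost)
    from this[of c] this[of c'] show ?thesis using assms(3) by simp
  next
    case False
    then have "i \<notin> keys c" "i \<notin> keys c'" using assms(1,2) by (auto simp: monoms_def)
    then show ?thesis by (simp add: in_keys_iff)
  qed
qed

text \<open>Each initial segment in the sum can only drop under \<open>g\<close>, and the order is
  compatible with addition.\<close>

lemma perm_stairs_le: "g permutes {1..n} \<Longrightarrow> perm_monom g (stairs n c) \<le> stairs n c"
  unfolding stairs_def perm_monom_sum[of _ _ "{1..n}"] by (intro sum_mono perm_flat_le)

lemma orbit_max_stairs [simp]: "orbit_max n (stairs n c) = stairs n c"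
  using orbit_max_eqI[OF permutes_id, of n "stairs n c"] perm_stairs_le by simp

text \<open>A sum whose terms can only drop is fixed just when every term is
  (\<open>sum_mono_inv\<close>). The stabiliser therefore depends on \<open>c\<close> only through
  its support, which is why one generator per support suffices.\<close>

lemma perm_stairs_eq_iff:
  assumes g: "g permutes {1..n}"
  shows "perm_monom g (stairs n c) = stairs n c \<longleftrightarrow> (\<forall>i\<in>keys c \<inter> {1..n}. g ` {1..i} = {1..i})"
proof
  assume "perm_monom g (stairs n c) = stairs n c"
  then have *: "(\<Sum>i=1..n. perm_monom g (\<Sum>j=1..i. single j (lookup c i))) =
      (\<Sum>i=1..n. \<Sum>j=1..i. single j (lookup c i))"
    unfolding stairs_def perm_monom_sum[of _ _ "{1..n}"] .
  have "perm_monom g (\<Sum>j=1..i. single j (lookup c i)) = (\<Sum>j=1..i. single j (lookup c i))"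
    if "i \<in> {1..n}" for i
    by (rule sum_mono_inv[OF *]) (use that perm_flat_le[OF g] in auto)
  then show "\<forall>i\<in>keys c \<inter> {1..n}. g ` {1..i} = {1..i}"
    unfolding perm_flat_eq_iff[OF g] by (metis IntD1 IntD2 in_keys_iff)
next
  assume "\<forall>i\<in>keys c \<inter> {1..n}. g ` {1..i} = {1..i}"
  then have "perm_monom g (\<Sum>j=1..i. single j (lookup c i)) = (\<Sum>j=1..i. single j (lookup c i))"
    if "i \<in> {1..n}" for i
    unfolding perm_flat_eq_iff[OF g] using that by (cases "i \<in> keys c") (auto simp: in_keys_iff)
  then show "perm_monom g (stairs n c) = stairs n c"
    unfolding stairs_def perm_monom_sum[of _ _ "{1..n}"] by (rule sum.cong[OF refl])
qed

lemma dominant_eq_stairs: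
  assumes m: "m \<in> monoms n" and dom: "orbit_max n m = m"
  obtains c where "c \<in> monoms n" "m = stairs n c"
proof
  \<comment> \<open>Successive differences; at \<open>i = n\<close> the subtracted exponent is 0.
    The truncated subtraction is exact once \<open>desc\<close> is known.\<close>
  let ?f = "\<lambda>i. if i \<in> {1..n} then lookup m i - lookup m (Suc i) else 0"
  define c where "c = Abs_poly_mapping ?f"
  have "finite {i. ?f i \<noteq> 0}" by (rule finite_subset[of _ "{1..n}"]) (auto split: if_splits)
  then have c: "lookup c i = ?f i" for i by (simp add: c_def)
  have "lookup c i = 0" if "i \<notin> {1..n}" for i
    unfolding c using that by (rule if_not_P)
  then have "i \<in> {1..n}" if "i \<in> keys c" for i
    using that unfolding in_keys_iff by metis
  then show "c \<in> monoms n" unfolding monoms_def by blast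
  have top: "lookup m i = 0" if "i \<notin> {1..n}" for i
    using m that by (auto simp: monoms_def in_keys_iff)
  \<comment> \<open>An ascent could be exchanged by an adjacent transposition, giving a larger
    monomial in the orbit.\<close>
  have desc: "lookup m (Suc i) \<le> lookup m i" if i: "i \<ge> 1" for i
  proof (rule ccontr)
    assume less: "\<not> lookup m (Suc i) \<le> lookup m i"
    then have "Suc i \<in> {1..n}" using top[of "Suc i"] by (cases "Suc i \<in> {1..n}") auto
    then have t: "transpose i (Suc i) permutes {1..n}"
      using i by (intro permutes_swap_id) auto
    have "m < perm_monom (transpose i (Suc i)) m"
      unfolding monom_less_iff using less
      by (intro exI[of _ i]) (simp add: lookup_perm_monom transpose_def)
    also have "\<dots> \<le> m" using orbit_max_ge[OF t, of m] dom by simp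
    finally show False by simp
  qed
  show "m = stairs n c"
  proof (rule poly_mapping_eqI)
    fix j show "lookup m j = lookup (stairs n c) j"
    proof (cases "j \<in> {1..n}")
      case True
      \<comment> \<open>Downward induction from \<open>Suc n\<close>, where the sum is empty and the
        exponent of \<open>m\<close> is 0; the differences telescope.\<close>
      have "j \<le> Suc n \<Longrightarrow> 1 \<le> j \<Longrightarrow> lookup m j = (\<Sum>i=j..n. lookup c i)" for j
      proof (induction rule: inc_induct)
        case base then show ?case by (simp add: top)
      next
        case (step j)
        then have "(\<Sum>i=j..n. lookup c i) = lookup c j + lookup m (Suc j)"
          by (simp add: sum.atLeast_Suc_atMost)
        then show ?case using step desc[of j] by (simp add: c)
      qed
      with True show ?thesis by (simp add: lookup_stairs)
    next
      case False
      then have "j \<notin> keys (stairs n c)" using stairs_in_monoms[of n c] by (auto simp: monoms_def)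
      then show ?thesis by (simp add: top[OF False] in_keys_iff)
    qed
  qed
qed

lemma monom_eq_perm_stairs:
  assumes "m \<in> monoms n"
  obtains g c where "g permutes {1..n}" "c \<in> monoms n" "m = perm_monom g (stairs n c)"
proof -
  obtain h where h: "h permutes {1..n}" "orbit_max n m = perm_monom h m"
    by (rule orbit_max_attained)
  obtain c where c: "c \<in> monoms n" "orbit_max n m = stairs n c"
    by (rule dominant_eq_stairs[OF orbit_max_in_monoms[OF assms]])
      (use orbit_max_perm[OF h(1), of m] h(2) in simp)
  have "m = perm_monom (inv' h) (stairs n c)"
    using perm_monom_inv(1)[OF permutes_bij[OF h(1)], of m] unfolding c(2)[symmetric] h(2) by (rule sym)
  with permutes_inv[OF h(1)] c(1) show thesis by (rule that)
qed

section \<open>Sums of monomials\<close>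

lemma keys_add_subset: "keys p \<subseteq> S \<Longrightarrow> keys q \<subseteq> S \<Longrightarrow> keys (p + q) \<subseteq> S"
  using Poly_Mapping.keys_add[of p q] by blast

lemma poly_mapping_sum_single:
  fixes p :: "'a \<Rightarrow>\<^sub>0 'b::comm_monoid_add"
  assumes "finite K" "keys p \<subseteq> K"
  shows "(\<Sum>m\<in>K. single m (lookup p m)) = p"
proof (rule poly_mapping_eqI)
  fix k
  have "lookup (\<Sum>m\<in>K. single m (lookup p m)) k = (\<Sum>m\<in>K. if k = m then lookup p k else 0)"
    unfolding lookup_sum by (intro sum.cong) (auto simp: lookup_single when_def)
  also have "\<dots> = lookup p k"
    using assms by (auto simp: in_keys_iff)
  finally show "lookup (\<Sum>m\<in>K. single m (lookup p m)) k = lookup p k" .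
qed

text \<open>Reduces an additive statement to single terms while keeping the support inside
  \<open>S\<close>. It serves for the ring laws of the group ring as well as for spanning
  arguments.\<close>

lemma poly_mapping_induct_on [consumes 1, case_names zero single add]:
  fixes p :: "'a \<Rightarrow>\<^sub>0 'b::comm_monoid_add"
  assumes "keys p \<subseteq> S" and zero: "P 0"
    and single: "\<And>m c. m \<in> S \<Longrightarrow> P (single m c)"
    and add: "\<And>p q. keys p \<subseteq> S \<Longrightarrow> keys q \<subseteq> S \<Longrightarrow> P p \<Longrightarrow> P q \<Longrightarrow> P (p + q)"
  shows "P p"
proof -
  have "keys (\<Sum>m\<in>K. single m (lookup p m)) \<subseteq> S \<and> P (\<Sum>m\<in>K. single m (lookup p m))"
    if "finite K" "K \<subseteq> S" for K
    using that
  proof (induction K rule: finite_induct)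
    case (insert m K)
    have "keys (single m (lookup p m)) \<subseteq> S" using insert by simp
    with insert show ?case
      using add single Poly_Mapping.keys_add[of "single m (lookup p m)" "\<Sum>m\<in>K. single m (lookup p m)"]
      by simp blast
  qed (simp add: zero)
  from this[of "keys p"] show ?thesis
    using assms(1) poly_mapping_sum_single[of "keys p" p] by simp
qed

lemma poly_mapping_induct [case_names single add]:
  fixes p :: "'a \<Rightarrow>\<^sub>0 'b::comm_monoid_add"
  assumes single: "\<And>m c. P (single m c)" and "\<And>p q. P p \<Longrightarrow> P q \<Longrightarrow> P (p + q)"
  shows "P p"
  using subset_UNIV[of "keys p"] single[of undefined 0]
  by (induction p rule: poly_mapping_induct_on) (simp_all add: assms)

section \<open>The group ring\<close>

lemma group_ring_simps [simp]:
  "carrier (group_ring G) = {r. keys r \<subseteq> carrier G}"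
  "\<one>\<^bsub>group_ring G\<^esub> = single \<one>\<^bsub>G\<^esub> 1"
  "\<zero>\<^bsub>group_ring G\<^esub> = 0"
  "r \<oplus>\<^bsub>group_ring G\<^esub> s = r + s"
  by (simp_all add: group_ring_def)

lemma group_ring_mult_superset:
  assumes "finite K" "keys r \<subseteq> K" "finite L" "keys s \<subseteq> L"
  shows "r \<otimes>\<^bsub>group_ring G\<^esub> s =
    (\<Sum>g\<in>K. \<Sum>h\<in>L. single (g \<otimes>\<^bsub>G\<^esub> h) (lookup r g * lookup s h))"
proof -
  have "r \<otimes>\<^bsub>group_ring G\<^esub> s =
      (\<Sum>g\<in>keys r. \<Sum>h\<in>L. single (g \<otimes>\<^bsub>G\<^esub> h) (lookup r g * lookup s h))"
    unfolding group_ring_def using assms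
    by (simp, intro sum.cong[OF refl] sum.mono_neutral_left) (auto simp: in_keys_iff)
  also have "\<dots> = (\<Sum>g\<in>K. \<Sum>h\<in>L. single (g \<otimes>\<^bsub>G\<^esub> h) (lookup r g * lookup s h))"
    using assms by (intro sum.mono_neutral_left) (auto simp: in_keys_iff)
  finally show ?thesis .
qed

lemma group_ring_mult_single:
  "single g a \<otimes>\<^bsub>group_ring G\<^esub> single h b = single (g \<otimes>\<^bsub>G\<^esub> h) (a * b)"
  by (subst group_ring_mult_superset[of "{g}" _ "{h}"]) auto

lemma group_ring_distrib:
  "(r + s) \<otimes>\<^bsub>group_ring G\<^esub> t = r \<otimes>\<^bsub>group_ring G\<^esub> t + s \<otimes>\<^bsub>group_ring G\<^esub> t"
  "t \<otimes>\<^bsub>group_ring G\<^esub> (r + s) = t \<otimes>\<^bsub>group_ring G\<^esub> r + t \<otimes>\<^bsub>group_ring G\<^esub> s"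
proof -
  let ?K = "keys r \<union> keys s \<union> keys t"
  have mult: "x \<otimes>\<^bsub>group_ring G\<^esub> y =
      (\<Sum>g\<in>?K. \<Sum>h\<in>?K. single (g \<otimes>\<^bsub>G\<^esub> h) (lookup x g * lookup y h))"
    if "keys x \<subseteq> ?K" "keys y \<subseteq> ?K" for x y
    using that by (intro group_ring_mult_superset) auto
  have "keys (r + s) \<subseteq> ?K" using Poly_Mapping.keys_add[of r s] by blast
  then show "(r + s) \<otimes>\<^bsub>group_ring G\<^esub> t = r \<otimes>\<^bsub>group_ring G\<^esub> t + s \<otimes>\<^bsub>group_ring G\<^esub> t"
    "t \<otimes>\<^bsub>group_ring G\<^esub> (r + s) = t \<otimes>\<^bsub>group_ring G\<^esub> r + t \<otimes>\<^bsub>group_ring G\<^esub> s"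
    by (simp_all add: mult le_supI1 le_supI2 lookup_add distrib_left distrib_right single_add sum.distrib)
qed

lemma group_ring_mult_zero [simp]:
  "0 \<otimes>\<^bsub>group_ring G\<^esub> t = 0" "t \<otimes>\<^bsub>group_ring G\<^esub> 0 = 0"
  by (simp_all add: group_ring_def)

lemma group_ring_mult_closed:
  assumes "group G" "keys r \<subseteq> carrier G" "keys s \<subseteq> carrier G"
  shows "keys (r \<otimes>\<^bsub>group_ring G\<^esub> s) \<subseteq> carrier G"
  using assms(2)
proof (induction r rule: poly_mapping_induct_on)
  case (single g a)
  show ?case
    using assms(3)
  proof (induction s rule: poly_mapping_induct_on)
    case (single h b)
    then show ?case
      using \<open>g \<in> carrier G\<close> assms(1) by (simp add: group_ring_mult_single group.is_monoid monoid.m_closed)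
  next
    case (add s t)
    then show ?case
      by (simp add: group_ring_distrib keys_add_subset)
  qed simp
next
  case (add r t)
  then show ?case
    by (simp add: group_ring_distrib keys_add_subset)
qed simp

lemma group_ring_assoc:
  assumes "group G" "keys r \<subseteq> carrier G" "keys s \<subseteq> carrier G" "keys t \<subseteq> carrier G"
  shows "(r \<otimes>\<^bsub>group_ring G\<^esub> s) \<otimes>\<^bsub>group_ring G\<^esub> t =
    r \<otimes>\<^bsub>group_ring G\<^esub> (s \<otimes>\<^bsub>group_ring G\<^esub> t)"
  using assms(2)
proof (induction r rule: poly_mapping_induct_on)
  case (single g a)
  show ?case
    using assms(3)
  proof (induction s rule: poly_mapping_induct_on)
    case (single h b)
    show ?case
      using assms(4)
    proof (induction t rule: poly_mapping_induct_on)
      case (single k c)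
      then show ?case
        using \<open>g \<in> carrier G\<close> \<open>h \<in> carrier G\<close> assms(1)
        by (simp add: group_ring_mult_single group.is_monoid monoid.m_assoc mult.assoc)
    qed (simp_all add: group_ring_distrib)
  qed (simp_all add: group_ring_distrib)
qed (simp_all add: group_ring_distrib)

lemma group_ring_one:
  assumes "group G" "keys r \<subseteq> carrier G"
  shows "single \<one>\<^bsub>G\<^esub> 1 \<otimes>\<^bsub>group_ring G\<^esub> r = r" "r \<otimes>\<^bsub>group_ring G\<^esub> single \<one>\<^bsub>G\<^esub> 1 = r"
proof -
  interpret group G by fact
  show "single \<one>\<^bsub>G\<^esub> 1 \<otimes>\<^bsub>group_ring G\<^esub> r = r"
    using assms(2) by (induction r rule: poly_mapping_induct_on)
      (simp_all add: group_ring_mult_single group_ring_distrib)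
  show "r \<otimes>\<^bsub>group_ring G\<^esub> single \<one>\<^bsub>G\<^esub> 1 = r"
    using assms(2) by (induction r rule: poly_mapping_induct_on)
      (simp_all add: group_ring_mult_single group_ring_distrib)
qed

text \<open>The group ring and the polynomials both live inside a type that is already an additive
  group, so closure under differences is the only real condition.\<close>

lemma abelian_group_if_additive:
  fixes M :: "('a::ab_group_add, 'b) ring_scheme"
  assumes "zero M = 0" "add M = (+)"
    and "0 \<in> carrier M" "\<And>x y. x \<in> carrier M \<Longrightarrow> y \<in> carrier M \<Longrightarrow> x - y \<in> carrier M"
  shows "abelian_group M"
proof (rule abelian_groupI)
  have uminus: "- x \<in> carrier M" if "x \<in> carrier M" for x
    using assms(3) assms(4)[of 0 x] that by simp
  show "x \<oplus>\<^bsub>M\<^esub> y \<in> carrier M" if "x \<in> carrier M" "y \<in> carrier M" for x y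
    using assms(4)[OF that(1) uminus[OF that(2)]] assms(2) by simp
  show "\<exists>y\<in>carrier M. y \<oplus>\<^bsub>M\<^esub> x = \<zero>\<^bsub>M\<^esub>" if "x \<in> carrier M" for x
    using assms(1,2) uminus[OF that] by (intro bexI[of _ "- x"]) simp_all
qed (simp_all add: assms add_ac)

lemma ring_group_ring:
  assumes "group G"
  shows "ring (group_ring G)"
proof (rule ringI)
  interpret group G by fact
  show "abelian_group (group_ring G)"
    by (rule abelian_group_if_additive) (auto simp: group_ring_def fun_eq_iff dest: subsetD[OF keys_diff])
  show "monoid (group_ring G)"
    by (rule monoidI)
      (simp_all add: assms group_ring_mult_closed group_ring_assoc group_ring_one)
qed (simp_all add: group_ring_distrib)

section \<open>The polynomials as a module\<close>

lemma perm_poly_single [simp]: "perm_poly g (single m c) = single (perm_monom g m) c"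
  by (cases "c = 0") (simp_all add: perm_poly_def)

lemma perm_poly_0 [simp]: "perm_poly g 0 = 0"
  by (simp add: perm_poly_def)

lemma perm_poly_sum: "perm_poly g (\<Sum>i\<in>I. f i) = (\<Sum>i\<in>I. perm_poly g (f i))"
  by (induction I rule: infinite_finite_induct) (auto simp: perm_poly_add)

lemma perm_poly_Const [simp]: "perm_poly g (Const c) = Const c"
  by (simp add: Const_def)

lemma perm_poly_mult: "perm_poly g (p * q) = perm_poly g p * perm_poly g q"
proof (induction p rule: poly_mapping_induct)
  case (single m a)
  show ?case
    by (induction q rule: poly_mapping_induct)
      (simp_all add: mult_single perm_monom_add distrib_left perm_poly_add)
qed (simp add: distrib_right perm_poly_add)

lemma perm_poly_1 [simp]: "perm_poly g 1 = 1"
  using perm_poly_single[of g 0 1] by simp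

lemma perm_poly_comp: "bij g \<Longrightarrow> bij h \<Longrightarrow> perm_poly (g \<circ> h) p = perm_poly g (perm_poly h p)"
  by (induction p rule: poly_mapping_induct) (simp_all add: perm_monom_comp perm_poly_add)

lemma perm_poly_id [simp]: "perm_poly id p = p"
  by (induction p rule: poly_mapping_induct) (simp_all add: perm_poly_add perm_monom_id[unfolded id_def] id_def)

lemma lookup_perm_poly:
  assumes "bij g"
  shows "lookup (perm_poly g p) (perm_monom g m) = lookup p m"
  by (induction p rule: poly_mapping_induct)
    (simp_all add: perm_poly_add lookup_add lookup_single assms)

lemma keys_perm_poly:
  assumes "bij g"
  shows "keys (perm_poly g p) = perm_monom g ` keys p"
proof -
  have *: "m \<in> keys (perm_poly g p) \<longleftrightarrow> perm_monom (inv' g) m \<in> keys p" for m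
    using lookup_perm_poly[OF assms, of p "perm_monom (inv' g) m"]
    by (simp add: in_keys_iff perm_monom_inv[OF assms])
  show ?thesis
  proof (intro equalityI subsetI)
    fix m assume "m \<in> keys (perm_poly g p)"
    then show "m \<in> perm_monom g ` keys p"
      using * by (intro image_eqI[of _ _ "perm_monom (inv' g) m"]) (simp_all add: perm_monom_inv[OF assms])
  next
    fix m assume "m \<in> perm_monom g ` keys p"
    then show "m \<in> keys (perm_poly g p)"
      by (auto simp: * perm_monom_inv[OF assms])
  qed
qed

lemma Const_mult: "Const (a * b) = Const a * Const b"
  and Const_add: "Const (a + b) = Const a + Const b"
  and Const_0 [simp]: "Const 0 = 0"
  and Const_1 [simp]: "Const 1 = 1"
  by (simp_all add: Const_def mult_single single_add)

lemma keys_Const_mult: "keys (Const c * p) \<subseteq> keys p"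
  by (auto simp: in_keys_iff lookup_Const_mult)

lemma zero_in_mpolys [simp]: "0 \<in> mpolys n"
  by (simp add: mpolys_def)

lemma Const_in_mpolys [simp]: "Const c \<in> mpolys n"
  by (cases "c = 0") (simp_all add: mpolys_def Const_def)

lemma one_in_mpolys [simp]: "1 \<in> mpolys n"
  using Const_in_mpolys[of 1 n] by simp

lemma mpolys_add: "p \<in> mpolys n \<Longrightarrow> q \<in> mpolys n \<Longrightarrow> p + q \<in> mpolys n"
  unfolding mpolys_iff by (rule keys_add_subset)

lemma mpolys_diff: "p \<in> mpolys n \<Longrightarrow> q \<in> mpolys n \<Longrightarrow> p - q \<in> mpolys n"
  unfolding mpolys_iff using keys_diff[of p q] by blast

lemma mpolys_mult: "p \<in> mpolys n \<Longrightarrow> q \<in> mpolys n \<Longrightarrow> p * q \<in> mpolys n"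
  unfolding mpolys_iff using Poly_Mapping.keys_mult[of p q] monoms_add by blast

lemma mpolys_sum: "(\<And>i. i \<in> I \<Longrightarrow> f i \<in> mpolys n) \<Longrightarrow> (\<Sum>i\<in>I. f i) \<in> mpolys n"
  by (induction I rule: infinite_finite_induct) (auto simp: mpolys_add)

lemma perm_poly_in_mpolys:
  "g permutes {1..n} \<Longrightarrow> p \<in> mpolys n \<Longrightarrow> perm_poly g p \<in> mpolys n"
  unfolding mpolys_iff by (auto simp: keys_perm_poly permutes_bij perm_monom_in_monoms)

lemma poly_module_simps [simp]:
  "carrier (poly_module n) = mpolys n"
  "\<zero>\<^bsub>poly_module n\<^esub> = 0"
  "\<one>\<^bsub>poly_module n\<^esub> = 1"
  "p \<oplus>\<^bsub>poly_module n\<^esub> q = p + q"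
  "p \<otimes>\<^bsub>poly_module n\<^esub> q = p * q"
  by (simp_all add: poly_module_def)

lemma abelian_group_poly_module: "abelian_group (poly_module n)"
  by (rule abelian_group_if_additive) (auto simp: poly_module_def mpolys_diff)

lemma uminus_poly_module:
  assumes "p \<in> mpolys n"
  shows "\<ominus>\<^bsub>poly_module n\<^esub> p = - p"
proof -
  interpret abelian_group "poly_module n" by (rule abelian_group_poly_module)
  show ?thesis
    using minus_equality[of "- p" p] assms mpolys_diff[of 0 n p] by simp
qed

text \<open>The scalar action of \<open>poly_module n\<close> does not involve \<open>n\<close>; a
  name of its own gives rewrite rules free of \<open>n\<close>.\<close>

definition poly_act :: "((nat \<Rightarrow> nat) \<Rightarrow>\<^sub>0 'k::ring_1) \<Rightarrow> 'k mpoly \<Rightarrow> 'k mpoly"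
  where "poly_act r p = (\<Sum>g\<in>keys r. Const (lookup r g) * perm_poly g p)"

lemma smult_poly_module [simp]: "r \<odot>\<^bsub>poly_module n\<^esub> p = poly_act r p"
  by (simp add: poly_module_def poly_act_def)

lemma poly_act_superset:
  assumes "finite K" "keys r \<subseteq> K"
  shows "poly_act r p = (\<Sum>g\<in>K. Const (lookup r g) * perm_poly g p)"
  using assms unfolding poly_act_def
  by (auto intro!: sum.mono_neutral_left simp: in_keys_iff)

lemma poly_act_single [simp]: "poly_act (single g c) p = Const c * perm_poly g p"
  by (subst poly_act_superset[of "{g}"]) auto

lemma poly_act_0 [simp]: "poly_act 0 p = 0" "poly_act r 0 = 0"
  by (simp_all add: poly_act_def)

lemma poly_act_add_left: "poly_act (r + s) p = poly_act r p + poly_act s p"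
proof -
  let ?K = "keys r \<union> keys s"
  have "poly_act z p = (\<Sum>g\<in>?K. Const (lookup z g) * perm_poly g p)" if "keys z \<subseteq> ?K" for z
    by (rule poly_act_superset) (use that in auto)
  from this[of r] this[of s] this[of "r + s"] show ?thesis
    using Poly_Mapping.keys_add[of r s]
    by (simp add: lookup_add Const_add distrib_right sum.distrib)
qed

lemma poly_act_add_right: "poly_act r (p + q) = poly_act r p + poly_act r q"
  by (simp add: poly_act_def perm_poly_add distrib_left sum.distrib)

lemma poly_act_sum: "poly_act r (\<Sum>i\<in>I. f i) = (\<Sum>i\<in>I. poly_act r (f i))"
  by (induction I rule: infinite_finite_induct) (simp_all add: poly_act_add_right)

text \<open>Permutations fix constants, so the permutation of the first factor passes the
  coefficient of the second, and the coefficients meet in the order in which the group ring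
  multiplies them.\<close>

lemma poly_act_mult:
  assumes "keys r \<subseteq> carrier (sym_group n)" "keys s \<subseteq> carrier (sym_group n)"
  shows "poly_act (r \<otimes>\<^bsub>kG n\<^esub> s) p = poly_act r (poly_act s p)"
  using assms(1)
proof (induction r rule: poly_mapping_induct_on)
  case (single g a)
  show ?case
    using assms(2)
  proof (induction s rule: poly_mapping_induct_on)
    case (single h b)
    then show ?case
      using \<open>g \<in> carrier (sym_group n)\<close>
      by (simp add: group_ring_mult_single sym_group_mult perm_poly_comp permutes_bij
          perm_poly_mult Const_mult mult.assoc)
  qed (simp_all add: group_ring_distrib poly_act_add_left poly_act_add_right perm_poly_add distrib_left
      del: carrier_sym_group)
qed (simp_all add: group_ring_distrib poly_act_add_left)

lemma poly_act_in_mpolys: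
  assumes "keys r \<subseteq> carrier (sym_group n)" "p \<in> mpolys n"
  shows "poly_act r p \<in> mpolys n"
  unfolding poly_act_def using assms
  by (intro mpolys_sum mpolys_mult perm_poly_in_mpolys) auto

lemma left_module_poly_module: "left_module (kG n) (poly_module n)"
proof -
  interpret R: ring "kG n" by (rule ring_group_ring[OF sym_group_is_group])
  interpret M: abelian_group "poly_module n" by (rule abelian_group_poly_module)
  show ?thesis
    by unfold_locales
      (simp_all add: poly_act_in_mpolys poly_act_add_left poly_act_add_right poly_act_mult sym_group_one)
qed

section \<open>Leading monomials\<close>

lemma mult_expand:
  "p * q = (\<Sum>k\<in>keys p. \<Sum>l\<in>keys q. single (k + l) (lookup p k * lookup q l))"
proof -
  have "p * q = (\<Sum>k\<in>keys p. single k (lookup p k)) * (\<Sum>l\<in>keys q. single l (lookup q l))"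
    by (simp add: poly_mapping_sum_single)
  then show ?thesis by (simp add: sum_product mult_single)
qed

text \<open>When only one pair of monomials can produce \<open>a + b\<close>, its coefficient is a
  single product and nothing can cancel.\<close>

lemma lookup_mult_unique:
  fixes p q :: "'a::monoid_add \<Rightarrow>\<^sub>0 'b::semiring_0"
  assumes "\<And>k l. k \<in> keys p \<Longrightarrow> l \<in> keys q \<Longrightarrow> k + l = a + b \<Longrightarrow> k = a \<and> l = b"
  shows "lookup (p * q) (a + b) = lookup p a * lookup q b"
proof -
  have "lookup (p * q) (a + b) =
      (\<Sum>k\<in>keys p. \<Sum>l\<in>keys q. if k + l = a + b then lookup p k * lookup q l else 0)"
    by (subst mult_expand) (simp add: lookup_sum lookup_single when_def)
  also have "\<dots> = (\<Sum>k\<in>keys p. if k = a then (\<Sum>l\<in>keys q. if l = b then lookup p k * lookup q l else 0) else 0)"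
  proof (rule sum.cong[OF refl])
    fix k assume k: "k \<in> keys p"
    show "(\<Sum>l\<in>keys q. if k + l = a + b then lookup p k * lookup q l else 0) =
        (if k = a then (\<Sum>l\<in>keys q. if l = b then lookup p k * lookup q l else 0) else 0)"
    proof (cases "k = a")
      case True
      then have "(k + l = a + b) = (l = b)" if "l \<in> keys q" for l using assms k that by blast
      then show ?thesis unfolding if_P[OF True] by (intro sum.cong refl) simp
    next
      case False
      then have "k + l \<noteq> a + b" if "l \<in> keys q" for l using assms k that by blast
      then show ?thesis unfolding if_not_P[OF False] by (intro sum.neutral) simp
    qed
  qed
  also have "\<dots> = lookup p a * lookup q b"
    by (simp add: in_keys_iff)
  finally show ?thesis .
qed

text \<open>The value \<open>c\<close> may be 0, and then \<open>m\<close> is merely an upper bound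
  for the monomials. In this form the notion passes to products even when coefficients multiply to
  0.\<close>

definition leads :: "('a::linorder \<Rightarrow>\<^sub>0 'b::zero) \<Rightarrow> 'a \<Rightarrow> 'b \<Rightarrow> bool"
  where "leads p m c \<longleftrightarrow> lookup p m = c \<and> (\<forall>m'\<in>keys p. m' \<le> m)"

text \<open>Two monomials below the leading ones, not both equal to them, have a strictly smaller
  sum, so the top monomial arises from one pair only.\<close>

lemma leads_mult:
  fixes p q :: "'a::{linorder, ordered_cancel_comm_monoid_add} \<Rightarrow>\<^sub>0 'b::semiring_0"
  assumes "leads p m a" "leads q m' b"
  shows "leads (p * q) (m + m') (a * b)"
proof -
  have "k = m \<and> l = m'" if "k \<in> keys p" "l \<in> keys q" "k + l = m + m'" for k l
  proof -
    have le: "k \<le> m" "l \<le> m'" using assms that by (auto simp: leads_def)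
    show ?thesis
    proof (rule ccontr)
      assume "\<not> (k = m \<and> l = m')"
      then have "k + l < m + m'"
        using le add_less_le_mono[of k m l m'] add_le_less_mono[of k m l m'] by auto
      then show False using that(3) by simp
    qed
  qed
  then have "lookup (p * q) (m + m') = a * b"
    using assms by (subst lookup_mult_unique) (auto simp: leads_def)
  moreover have "k \<le> m + m'" if "k \<in> keys (p * q)" for k
    using subsetD[OF Poly_Mapping.keys_mult that] assms by (auto simp: leads_def intro: add_mono)
  ultimately show ?thesis by (simp add: leads_def)
qed

lemma leads_one: "leads (1 :: 'a::{linorder, zero} \<Rightarrow>\<^sub>0 'b::zero_neq_one) 0 1"
  by (simp add: leads_def lookup_one)

lemma leads_prod_list:
  fixes f :: "'i \<Rightarrow> 'a::{linorder, ordered_cancel_comm_monoid_add} \<Rightarrow>\<^sub>0 'b::semiring_1"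
  assumes "\<And>i. i \<in> set is \<Longrightarrow> leads (f i) (m i) 1"
  shows "leads (prod_list (map f is)) (sum_list (map m is)) 1"
  using assms
proof (induction "is")
  case (Cons i "is")
  then show ?case using leads_mult[of "f i" "m i" 1 _ _ 1] by simp
qed (simp add: leads_one)

lemma lm_lex_leads:
  assumes "leads p m c" "c \<noteq> 0"
  shows "lm_lex p = m"
  unfolding lm_lex_def using assms by (intro Max_eqI) (auto simp: leads_def in_keys_iff)

section \<open>Powers of elementary symmetric polynomials\<close>

text \<open>The type of polynomials is noncommutative, but monomials with coefficient 1 are central.
  The elementary symmetric polynomials inherit this, as sums of such monomials.\<close>

lemma single_one_commute:
  fixes p :: "'a::comm_monoid_add \<Rightarrow>\<^sub>0 'b::semiring_1"
  shows "single m 1 * p = p * single m 1"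
  by (induction p rule: poly_mapping_induct)
    (simp_all add: mult_single add.commute distrib_left distrib_right)

lemma elem_sym_commute: "elem_sym n i * p = p * elem_sym n i"
  by (simp add: elem_sym_def sum_distrib_left sum_distrib_right single_one_commute)

lemma perm_sqfree_monom:
  "g permutes S \<Longrightarrow> perm_monom g (sqfree_monom A) = sqfree_monom (g ` A)"
  by (simp add: sqfree_monom_def perm_flat permutes_inj_on)

text \<open>A permutation of \<open>{1..n}\<close> permutes the subsets of size \<open>i\<close>,
  hence the summands.\<close>

lemma perm_elem_sym:
  assumes g: "g permutes {1..n}"
  shows "perm_poly g (elem_sym n i) = elem_sym n i"
proof -
  let ?S = "{A. A \<subseteq> {1..n} \<and> card A = i}"
  have sub: "h ` A \<in> ?S" if "h permutes {1..n}" "A \<in> ?S" for h A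
  proof -
    have "h ` A \<subseteq> h ` {1..n}" using that by blast
    then show ?thesis
      using that permutes_image[OF that(1)] by (auto simp: card_image permutes_inj_on)
  qed
  have "bij_betw ((`) g) ?S ?S"
  proof (rule bij_betw_byWitness[where f' = "(`) (inv' g)"])
    show "\<forall>A\<in>?S. inv' g ` g ` A = A" "\<forall>A\<in>?S. g ` inv' g ` A = A"
      by (simp_all add: image_image permutes_inverses[OF g])
    show "(`) g ` ?S \<subseteq> ?S" "(`) (inv' g) ` ?S \<subseteq> ?S"
      using sub[OF g] sub[OF permutes_inv[OF g]] by blast+
  qed
  then have "(\<Sum>A\<in>?S. single (sqfree_monom (g ` A)) 1) = (\<Sum>A\<in>?S. single (sqfree_monom A) 1)"
    by (rule sum.reindex_bij_betw)
  then show ?thesis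
    unfolding elem_sym_def perm_poly_sum perm_poly_single perm_sqfree_monom[OF g] .
qed

lemma keys_elem_sym: "keys (elem_sym n i) \<subseteq> sqfree_monom ` {A. A \<subseteq> {1..n} \<and> card A = i}"
  unfolding elem_sym_def by (rule order_trans[OF keys_sum]) auto

lemma keys_sqfree_monom: "finite A \<Longrightarrow> keys (sqfree_monom A) = A"
proof -
  assume "finite A"
  then have "lookup (sqfree_monom A) i = (if i \<in> A then 1 else 0)" for i
    unfolding sqfree_monom_def by (rule lookup_flat)
  then have "i \<in> keys (sqfree_monom A) \<longleftrightarrow> i \<in> A" for i
    unfolding in_keys_iff by simp
  then show ?thesis by blast
qed

lemma elem_sym_in_mpolys: "elem_sym n i \<in> mpolys n"
  unfolding mpolys_iff
proof (rule order_trans[OF keys_elem_sym], rule image_subsetI)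
  fix A assume "A \<in> {A. A \<subseteq> {1..n} \<and> card A = i}"
  then show "sqfree_monom A \<in> monoms n"
    using finite_subset[of A "{1..n}"] by (simp add: monoms_def keys_sqfree_monom)
qed

lemma leads_elem_sym:
  assumes "i \<le> n"
  shows "leads (elem_sym n i :: 'k::ring_1 mpoly) (sqfree_monom {1..i}) 1"
proof -
  let ?S = "{A. A \<subseteq> {1..n} \<and> card A = i}"
  have fin: "finite A" if "A \<in> ?S" for A using that finite_subset[of A "{1..n}"] by simp
  have "lookup (elem_sym n i :: 'k mpoly) (sqfree_monom {1..i}) = (\<Sum>A\<in>?S. if A = {1..i} then 1 else 0)"
    unfolding elem_sym_def lookup_sum lookup_single
  proof (rule sum.cong[OF refl])
    fix A assume "A \<in> ?S"
    then have "sqfree_monom A = sqfree_monom {1..i} \<longleftrightarrow> A = {1..i}"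
      using keys_sqfree_monom[OF fin] keys_sqfree_monom[of "{1..i}"] by (metis finite_atLeastAtMost)
    then show "(1 when sqfree_monom A = sqfree_monom {1..i}) = (if A = {1..i} then 1 else 0 :: 'k)"
      by (simp add: when_def)
  qed
  also have "\<dots> = 1" using assms by simp
  finally have "lookup (elem_sym n i :: 'k mpoly) (sqfree_monom {1..i}) = 1" .
  moreover have "m \<le> sqfree_monom {1..i}" if "m \<in> keys (elem_sym n i :: 'k mpoly)" for m
    using subsetD[OF keys_elem_sym that] flat_le[of _ n i 1] by (auto simp: sqfree_monom_def)
  ultimately show ?thesis by (simp add: leads_def)
qed

definition elem_sym_power :: "nat \<Rightarrow> monom \<Rightarrow> 'k::ring_1 mpoly"
  where "elem_sym_power n a = prod_list (map (\<lambda>i. elem_sym n i ^ lookup a i) [1..<Suc n])"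

lemma commute_power:
  fixes x :: "'a::monoid_mult"
  assumes "\<And>y. x * y = y * x"
  shows "x ^ k * y = y * x ^ k"
  by (induction k) (simp_all add: assms mult.assoc[symmetric], metis assms mult.assoc)

lemma commute_prod_list:
  fixes f :: "'i \<Rightarrow> 'a::monoid_mult"
  assumes "\<And>i y. f i * y = y * f i"
  shows "prod_list (map f is) * y = y * prod_list (map f is)"
  by (induction "is") (simp_all add: mult.assoc, metis assms mult.assoc)

lemma elem_sym_power_commute: "elem_sym_power n a * p = p * elem_sym_power n a"
  unfolding elem_sym_power_def by (intro commute_prod_list commute_power elem_sym_commute)

lemma elem_sym_power_0 [simp]: "elem_sym_power n 0 = 1"
proof -
  have "prod_list (map (\<lambda>i. 1) xs) = (1 :: 'a mpoly)" for xs :: "nat list"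
    by (induction xs) auto
  then show ?thesis by (simp add: elem_sym_power_def del: upt_Suc)
qed

lemma elem_sym_power_add:
  "elem_sym_power n (a + b) = elem_sym_power n a * (elem_sym_power n b :: 'k::ring_1 mpoly)"
proof -
  have "prod_list (map (\<lambda>i. elem_sym n i ^ lookup (a + b) i) xs) =
      prod_list (map (\<lambda>i. elem_sym n i ^ lookup a i) xs) *
      (prod_list (map (\<lambda>i. elem_sym n i ^ lookup b i) xs) :: 'k mpoly)"
    for xs
  proof (induction xs)
    case (Cons i xs)
    let ?A = "prod_list (map (\<lambda>i. elem_sym n i ^ lookup a i) xs) :: 'k mpoly"
    let ?B = "prod_list (map (\<lambda>i. elem_sym n i ^ lookup b i) xs) :: 'k mpoly"
    have "elem_sym n i ^ lookup b i * ?A = ?A * elem_sym n i ^ lookup b i"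
      by (rule commute_power) (rule elem_sym_commute)
    then have "elem_sym n i ^ lookup b i * (?A * ?B) = ?A * (elem_sym n i ^ lookup b i * ?B)"
      by (simp only: mult.assoc[symmetric])
    then show ?case
      using Cons by (simp only: list.map prod_list.Cons lookup_add power_add mult.assoc)
  qed simp
  then show ?thesis by (simp only: elem_sym_power_def)
qed

lemma elem_sym_power_single:
  assumes "i \<in> {1..n}"
  shows "elem_sym_power n (single i 1) = elem_sym n i"
proof -
  have "prod_list (map (\<lambda>j. elem_sym n j ^ lookup (single i 1) j) xs) = (if i \<in> set xs then elem_sym n i else 1)"
    if "distinct xs" for xs
    using that by (induction xs) (auto simp: lookup_single when_def)
  from this[of "[1..<Suc n]"] show ?thesis
    using assms by (simp add: elem_sym_power_def del: upt_Suc)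
qed

lemma prod_list_closed:
  assumes "1 \<in> S" "\<And>x y. x \<in> S \<Longrightarrow> y \<in> S \<Longrightarrow> x * y \<in> S" "set xs \<subseteq> S"
  shows "prod_list xs \<in> S"
  using assms(3) by (induction xs) (simp_all add: assms)

lemma power_closed:
  assumes "1 \<in> S" "\<And>x y. x \<in> S \<Longrightarrow> y \<in> S \<Longrightarrow> x * y \<in> S" "x \<in> S"
  shows "x ^ k \<in> S"
  by (induction k) (simp_all add: assms)

lemma elem_sym_power_in_mpolys: "elem_sym_power n a \<in> mpolys n"
  unfolding elem_sym_power_def
  by (intro prod_list_closed) (auto intro!: mpolys_mult power_closed elem_sym_in_mpolys)

lemma perm_elem_sym_power:
  assumes "g permutes {1..n}"
  shows "perm_poly g (elem_sym_power n a) = elem_sym_power n a"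
proof -
  let ?S = "{p. perm_poly g p = p}"
  have "elem_sym_power n a \<in> ?S"
    unfolding elem_sym_power_def
    by (intro prod_list_closed)
      (auto simp: perm_poly_mult perm_elem_sym[OF assms] intro!: power_closed[of ?S, simplified])
  then show ?thesis by simp
qed

text \<open>The constant sum stands for the k-fold multiple of \<open>m\<close>, as the type class
  has no multiplication by natural numbers.\<close>

lemma leads_power:
  fixes p :: "'a::{linorder, ordered_cancel_comm_monoid_add} \<Rightarrow>\<^sub>0 'b::semiring_1"
  assumes "leads p m 1"
  shows "leads (p ^ k) (\<Sum>i<k. m) 1"
proof (induction k)
  case (Suc k)
  then show ?case using leads_mult[OF assms Suc] by (simp add: add.commute)
qed (simp add: leads_one)

lemma leads_elem_sym_power: "leads (elem_sym_power n a) (stairs n a) 1"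
proof -
  have flat: "(\<Sum>i<k. single j (Suc 0)) = single j k" for j k :: nat
    by (induction k) (simp_all add: single_add[symmetric] del: sum_constant)
  have *: "(\<Sum>l<k. sqfree_monom {1..i}) = (\<Sum>j=1..i. single j k)" for i k
    unfolding sqfree_monom_def by (subst sum.swap) (simp add: flat del: sum_constant)
  have "leads (elem_sym_power n a) (sum_list (map (\<lambda>i. \<Sum>j=1..i. single j (lookup a i)) [1..<Suc n])) 1"
    unfolding elem_sym_power_def *[symmetric]
    by (intro leads_prod_list leads_power leads_elem_sym) auto
  also have "sum_list (map (\<lambda>i. \<Sum>j=1..i. single j (lookup a i)) [1..<Suc n]) = stairs n a"
    unfolding stairs_def interv_sum_list_conv_sum_set_nat set_upt by (simp only: atLeastLessThanSuc_atLeastAtMost)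
  finally show ?thesis .
qed

lemma stairs_sum: "stairs n (\<Sum>i\<in>A. f i) = (\<Sum>i\<in>A. stairs n (f i))"
  by (induction A rule: infinite_finite_induct) (auto simp: stairs_add)

text \<open>The product over \<open>I\<close> leads with the sum of the segments
  \<open>{1..i}\<close> for \<open>i \<in> I\<close>. Dividing by d_n removes exactly the segment of
  \<open>n\<close>, and the others are the stairs of the indicator vector of
  \<open>I - {n}\<close>.\<close>

lemma top_monom_eq:
  assumes "n \<in> I" "I \<subseteq> {1..n}"
  shows "top_monom TYPE('k::ring_1) n I = stairs n (sqfree_monom (I - {n}))"
proof -
  have fin: "finite I" using assms finite_subset by blast
  have "leads (elem_sym_prod n I :: 'k mpoly)
      (sum_list (map (\<lambda>i. sqfree_monom {1..i}) (sorted_list_of_set I))) 1"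
    unfolding elem_sym_prod_def
    by (intro leads_prod_list leads_elem_sym) (use fin assms in auto)
  also have "sum_list (map (\<lambda>i. sqfree_monom {1..i}) (sorted_list_of_set I)) = (\<Sum>i\<in>I. sqfree_monom {1..i})"
    using fin by (simp add: sum_list_distinct_conv_sum_set)
  finally have "lm_lex (elem_sym_prod n I :: 'k mpoly) = (\<Sum>i\<in>I. sqfree_monom {1..i})"
    by (rule lm_lex_leads) simp
  also have "\<dots> = sqfree_monom {1..n} + (\<Sum>i\<in>I - {n}. sqfree_monom {1..i})"
    using fin assms by (intro sum.remove)
  finally have "top_monom TYPE('k) n I = (\<Sum>i\<in>I - {n}. sqfree_monom {1..i})"
    by (simp add: top_monom_def)
  also have "\<dots> = (\<Sum>i\<in>I - {n}. stairs n (single i 1))"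
  proof (rule sum.cong[OF refl])
    fix i assume "i \<in> I - {n}"
    then show "sqfree_monom {1..i} = stairs n (single i 1)"
      using assms stairs_single[of i n 1] by (auto simp: sqfree_monom_def)
  qed
  also have "\<dots> = stairs n (sqfree_monom (I - {n}))"
    by (simp add: sqfree_monom_def stairs_sum)
  finally show ?thesis .
qed

section \<open>The basis of products\<close>

locale leading_generators =
  fixes n :: nat and e :: "nat set \<Rightarrow> 'k::ring_1 mpoly"
  assumes n_pos: "n \<ge> 1"
    and e_in_mpolys: "{n} \<subseteq> I \<Longrightarrow> I \<subseteq> {1..n} \<Longrightarrow> e I \<in> mpolys n"
    and G_lm_e: "{n} \<subseteq> I \<Longrightarrow> I \<subseteq> {1..n} \<Longrightarrow> G_lm n (e I) = {top_monom TYPE('k) n I}"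
    and stab_e: "{n} \<subseteq> I \<Longrightarrow> I \<subseteq> {1..n} \<Longrightarrow> stab_poly n (e I) = stab_monom n (lm_lex (e I))"
    and unit_e: "{n} \<subseteq> I \<Longrightarrow> I \<subseteq> {1..n} \<Longrightarrow>
           two_sided_unit (lookup (e I) (top_monom TYPE('k) n I))"
begin

text \<open>The exponents, in terms of the d_i, of the monomial prescribed as leading for
  \<open>e I\<close>; see \<open>top_e\<close>.\<close>

definition base :: "nat set \<Rightarrow> monom"
  where "base I = sqfree_monom (I - {n})"

text \<open>Inserting \<open>n\<close> makes this an admissible index set and leaves the stabiliser
  condition unchanged, since every permutation preserves \<open>{1..n}\<close>.\<close>

definition supp :: "monom \<Rightarrow> nat set"
  where "supp c = insert n (keys c)"

text \<open>What remains for the symmetric factor once \<open>e (supp c)\<close> has accounted for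
  one unit of each exponent away from \<open>n\<close>. The truncated difference is exact by
  \<open>rest_add_base\<close>.\<close>

definition rest :: "monom \<Rightarrow> monom"
  where "rest c = c - base (supp c)"

lemma supp_bounds: "c \<in> monoms n \<Longrightarrow> {n} \<subseteq> supp c \<and> supp c \<subseteq> {1..n}"
  using n_pos by (auto simp: supp_def monoms_def)

lemma lookup_base: "finite I \<Longrightarrow> lookup (base I) i = (if i \<in> I \<and> i \<noteq> n then 1 else 0)"
  by (simp add: base_def sqfree_monom_def lookup_flat)

lemma keys_base: "finite I \<Longrightarrow> keys (base I) = I - {n}"
  by (simp add: base_def keys_sqfree_monom)

lemma finite_supp: "finite (supp c)"
  by (simp add: supp_def)

lemma rest_add_base: "rest c + base (supp c) = c"
proof (rule poly_mapping_eqI)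
  fix i
  have "lookup (base (supp c)) i \<le> lookup c i"
    unfolding lookup_base[OF finite_supp] by (auto simp: supp_def in_keys_iff)
  then show "lookup (rest c + base (supp c)) i = lookup c i"
    by (simp add: rest_def lookup_add lookup_minus)
qed

lemma keys_rest: "keys (rest c) \<subseteq> supp c"
proof
  fix i assume "i \<in> keys (rest c)"
  then have "lookup (rest c) i \<noteq> 0" by (simp only: in_keys_iff not_False_eq_True)
  then have "lookup c i \<noteq> 0" by (simp add: rest_def lookup_minus)
  then show "i \<in> supp c" by (simp add: supp_def in_keys_iff)
qed

text \<open>\<open>base I\<close> makes all exponents in \<open>I - {n}\<close> positive, so
  \<open>I\<close> can be read off from the sum. Together with \<open>rest_add_base\<close> this
  matches the pairs of an index set and an exponent vector supported in it with the vectors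
  \<open>c\<close>.\<close>

lemma supp_add_base:
  assumes "keys a \<subseteq> I" "n \<in> I" "finite I"
  shows "supp (a + base I) = I" and "rest (a + base I) = a"
proof -
  have "i \<in> supp (a + base I) \<longleftrightarrow> i \<in> I" for i
    using assms by (auto simp: supp_def in_keys_iff lookup_add lookup_base)
  then show *: "supp (a + base I) = I" by blast
  show "rest (a + base I) = a" by (simp add: rest_def *)
qed

text \<open>Fixing the stairs of \<open>base I\<close> means preserving the segments
  \<open>{1..i}\<close> for \<open>i \<in> I - {n}\<close>, and the segment for \<open>n\<close> is
  always preserved. No other segment occurs in \<open>stairs n a\<close>.\<close>

lemma fixes_supp:
  assumes g: "g permutes {1..n}" and "perm_monom g (stairs n (base I)) = stairs n (base I)"
    and "finite I" "keys a \<subseteq> I"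
  shows "perm_monom g (stairs n a) = stairs n a"
  unfolding perm_stairs_eq_iff[OF g]
proof
  fix i assume i: "i \<in> keys a \<inter> {1..n}"
  show "g ` {1..i} = {1..i}"
  proof (cases "i = n")
    case True
    then show ?thesis using permutes_image[OF g] by simp
  next
    case False
    then have "i \<in> keys (base I) \<inter> {1..n}" using i assms(3,4) by (auto simp: keys_base)
    with assms(2) show ?thesis unfolding perm_stairs_eq_iff[OF g] by (rule bspec)
  qed
qed

lemma fixes_base:
  assumes g: "g permutes {1..n}" and "perm_monom g (stairs n c) = stairs n c"
  shows "perm_monom g (stairs n (base (supp c))) = stairs n (base (supp c))"
  using assms(2) unfolding perm_stairs_eq_iff[OF g] keys_base[OF finite_supp]
  by (auto simp: supp_def)

lemma top_e: "{n} \<subseteq> I \<Longrightarrow> I \<subseteq> {1..n} \<Longrightarrow> top_monom TYPE('k) n I = stairs n (base I)"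
  unfolding base_def by (rule top_monom_eq) auto

lemma e_top_in_keys:
  assumes "{n} \<subseteq> I" "I \<subseteq> {1..n}"
  shows "stairs n (base I) \<in> keys (e I)"
  using G_lm_e[OF assms] unfolding top_e[OF assms] G_lm_def by blast

text \<open>\<open>G_lm\<close> is a singleton, so a second monomial whose orbit reaches the maximum
  would contradict it.\<close>

lemma e_lower:
  assumes I: "{n} \<subseteq> I" "I \<subseteq> {1..n}" and m: "m \<in> keys (e I)" "m \<noteq> stairs n (base I)"
  shows "orbit_max n m < stairs n (base I)"
proof -
  have G: "G_lm n (e I) = {stairs n (base I)}" using G_lm_e[OF I] top_e[OF I] by simp
  then have "stairs n (base I) \<in> G_lm n (e I)" by simp
  then have le: "\<forall>y\<in>keys (e I). orbit_max n y \<le> stairs n (base I)"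
    by (simp add: G_lm_def)
  moreover have "orbit_max n m \<noteq> stairs n (base I)"
  proof
    assume "orbit_max n m = stairs n (base I)"
    then have "m \<in> G_lm n (e I)" using le m by (simp add: G_lm_def)
    then show False using G m by simp
  qed
  ultimately show ?thesis using m by (simp add: order_less_le)
qed

text \<open>A monomial never exceeds its orbit maximum, so the bound on orbits is also a
  lexicographic one. This identifies \<open>lm_lex (e I)\<close> in the stabiliser
  hypothesis.\<close>

lemma leads_e:
  assumes I: "{n} \<subseteq> I" "I \<subseteq> {1..n}"
  shows "leads (e I) (stairs n (base I)) (lookup (e I) (stairs n (base I)))"
  unfolding leads_def
proof (intro conjI ballI refl)
  fix m assume "m \<in> keys (e I)"
  then show "m \<le> stairs n (base I)"
    using e_lower[OF I] le_orbit_max[of m n] by (cases "m = stairs n (base I)") force+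
qed

lemma perm_e_iff:
  assumes I: "{n} \<subseteq> I" "I \<subseteq> {1..n}" and g: "g permutes {1..n}"
  shows "perm_poly g (e I) = e I \<longleftrightarrow> perm_monom g (stairs n (base I)) = stairs n (base I)"
proof -
  have "lm_lex (e I) = stairs n (base I)"
    by (rule lm_lex_leads[OF leads_e[OF I]]) (use e_top_in_keys[OF I] in \<open>simp add: in_keys_iff\<close>)
  then have "stab_poly n (e I) = stab_monom n (stairs n (base I))" using stab_e[OF I] by simp
  then show ?thesis using g unfolding stab_poly_def stab_monom_def by auto
qed

text \<open>The permutation \<open>inv' h \<circ> g\<close> fixes the leading monomial and so, by
  the stabiliser hypothesis, \<open>e I\<close> itself. A translate of \<open>e I\<close> is thus
  determined by the translate of its leading monomial.\<close>

lemma perm_e_eq: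
  assumes I: "{n} \<subseteq> I" "I \<subseteq> {1..n}" and g: "g permutes {1..n}" and h: "h permutes {1..n}"
    and eq: "perm_monom g (stairs n (base I)) = perm_monom h (stairs n (base I))"
  shows "perm_poly g (e I) = perm_poly h (e I)"
proof -
  have k: "inv' h \<circ> g permutes {1..n}" by (intro permutes_compose permutes_inv g h)
  have b: "bij g" "bij h" "bij (inv' h)" "bij (inv' h \<circ> g)"
    using g h k permutes_bij bij_imp_bij_inv by blast+
  have "perm_monom (inv' h \<circ> g) (stairs n (base I)) = stairs n (base I)"
    by (simp add: perm_monom_comp b eq perm_monom_inv)
  then have *: "perm_poly (inv' h \<circ> g) (e I) = e I" using perm_e_iff[OF I k] by simp
  have "h \<circ> (inv' h \<circ> g) = g"
    using permutes_inverses[OF h] by (simp add: fun_eq_iff)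
  then have "perm_poly g (e I) = perm_poly h (perm_poly (inv' h \<circ> g) (e I))"
    using perm_poly_comp[OF b(2,4), of "e I"] by simp
  then show ?thesis by (simp only: *)
qed

section \<open>Products attached to dominant monomials, and their lower terms\<close>

definition product :: "monom \<Rightarrow> 'k mpoly"
  where "product c = elem_sym_power n (rest c) * e (supp c)"

lemma stairs_rest_base: "stairs n (rest c) + stairs n (base (supp c)) = stairs n c"
  by (simp add: stairs_add[symmetric] rest_add_base)

lemma lookup_product:
  assumes "c \<in> monoms n"
  shows "lookup (product c) (stairs n c) = lookup (e (supp c)) (stairs n (base (supp c)))"
  using leads_mult[OF leads_elem_sym_power leads_e, of "supp c" n "rest c"] supp_bounds[OF assms]
  unfolding stairs_rest_base product_def by (simp add: leads_def)

text \<open>Let \<open>m = k + l\<close> with \<open>k\<close> from the symmetric factor and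
  \<open>l\<close> from \<open>e (supp c)\<close>, and let \<open>h\<close> carry \<open>m\<close>
  to its orbit maximum. Invariance of the symmetric factor bounds \<open>perm_monom h k\<close>, and
  \<open>e_lower\<close> bounds \<open>perm_monom h l\<close>. If the sum is not below the total
  bound, both bounds are attained. Then \<open>l\<close> is the leading monomial by
  \<open>e_lower\<close>, so \<open>h\<close> fixes it and, by \<open>fixes_supp\<close>, the
  leading monomial of the symmetric factor too. As \<open>h\<close> acts injectively,
  \<open>k\<close> is that monomial.\<close>

lemma product_lower:
  assumes c: "c \<in> monoms n" and m: "m \<in> keys (product c)" "m \<noteq> stairs n c"
  shows "orbit_max n m < stairs n c"
proof -
  let ?D = "elem_sym_power n (rest c) :: 'k mpoly"
  let ?I = "supp c" let ?y = "stairs n (base ?I)"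
  have I: "{n} \<subseteq> ?I" "?I \<subseteq> {1..n}" using supp_bounds[OF c] by auto
  obtain k l where kl: "m = k + l" "k \<in> keys ?D" "l \<in> keys (e ?I)"
    using subsetD[OF Poly_Mapping.keys_mult m(1)[unfolded product_def]] by blast
  obtain h where h: "h permutes {1..n}" "orbit_max n m = perm_monom h m" by (rule orbit_max_attained)
  have "perm_monom h k \<in> keys (perm_poly h ?D)"
    using kl by (simp add: keys_perm_poly permutes_bij[OF h(1)])
  then have k: "perm_monom h k \<le> stairs n (rest c)"
    using leads_elem_sym_power[of n "rest c", where 'a = 'k]
    by (simp add: perm_elem_sym_power[OF h(1)] leads_def)
  have l: "perm_monom h l \<le> ?y"
  proof (cases "l = ?y")
    case False
    then show ?thesis using e_lower[OF I kl(3)] orbit_max_ge[OF h(1), of l] by force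
  qed (simp add: perm_stairs_le[OF h(1)])
  have split: "orbit_max n m = perm_monom h k + perm_monom h l"
    unfolding h(2) unfolding kl(1) by (rule perm_monom_add)
  show ?thesis
  proof (rule ccontr)
    assume "\<not> orbit_max n m < stairs n c"
    then have ge: "\<not> perm_monom h k + perm_monom h l < stairs n (rest c) + ?y"
      by (simp add: split stairs_rest_base)
    have hk: "perm_monom h k = stairs n (rest c)" and hl: "perm_monom h l = ?y"
      using ge k l add_less_le_mono[of "perm_monom h k" "stairs n (rest c)" "perm_monom h l" ?y]
        add_le_less_mono[of "perm_monom h k" "stairs n (rest c)" "perm_monom h l" ?y]
      by (auto simp: order_less_le)
    have "l = ?y"
      using e_lower[OF I kl(3)] orbit_max_ge[OF h(1), of l] hl by force
    with hl have "perm_monom h (stairs n (rest c)) = stairs n (rest c)"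
      by (intro fixes_supp[OF h(1) _ finite_supp keys_rest]) simp
    with hk have "perm_monom h k = perm_monom h (stairs n (rest c))" by simp
    then have "k = stairs n (rest c)" using permutes_bij[OF h(1)] by simp
    with \<open>l = ?y\<close> have "m = stairs n c" by (simp add: kl stairs_rest_base)
    with m(2) show False by simp
  qed
qed

text \<open>In general several permutations qualify; \<open>gen_part_perm_stairs\<close> shows that
  they all yield the same translate of the generator.\<close>

definition sorter :: "monom \<Rightarrow> nat \<Rightarrow> nat"
  where "sorter x = (SOME g. g permutes {1..n} \<and> x = perm_monom g (orbit_max n x))"

definition exps :: "monom \<Rightarrow> monom"
  where "exps x = (SOME c. c \<in> monoms n \<and> orbit_max n x = stairs n c)"

lemma exps_props:
  assumes "x \<in> monoms n"
  shows "exps x \<in> monoms n" "orbit_max n x = stairs n (exps x)"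
proof -
  obtain g c where "g permutes {1..n}" "c \<in> monoms n" "x = perm_monom g (stairs n c)"
    using monom_eq_perm_stairs[OF assms] by metis
  then have "c \<in> monoms n \<and> orbit_max n x = stairs n c" by simp
  then have "exps x \<in> monoms n \<and> orbit_max n x = stairs n (exps x)"
    unfolding exps_def by (rule someI)
  then show "exps x \<in> monoms n" "orbit_max n x = stairs n (exps x)" by auto
qed

lemma sorter_props:
  assumes "x \<in> monoms n"
  shows "sorter x permutes {1..n}" "perm_monom (sorter x) (stairs n (exps x)) = x"
proof -
  obtain g c where "g permutes {1..n}" "c \<in> monoms n" "x = perm_monom g (stairs n c)"
    using monom_eq_perm_stairs[OF assms] by metis
  then have "\<exists>g. g permutes {1..n} \<and> x = perm_monom g (orbit_max n x)"
    by (intro exI[of _ g]) simp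
  from someI_ex[OF this] have "sorter x permutes {1..n} \<and> x = perm_monom (sorter x) (orbit_max n x)"
    unfolding sorter_def .
  then show "sorter x permutes {1..n}" "perm_monom (sorter x) (stairs n (exps x)) = x"
    using exps_props(2)[OF assms] by auto
qed

lemma exps_perm_stairs:
  assumes "g permutes {1..n}" "c \<in> monoms n"
  shows "exps (perm_monom g (stairs n c)) = c"
proof -
  have x: "perm_monom g (stairs n c) \<in> monoms n"
    using assms by (intro perm_monom_in_monoms stairs_in_monoms)
  show ?thesis
    by (rule stairs_inj[OF exps_props(1)[OF x] assms(2)])
      (simp add: exps_props(2)[OF x, symmetric] orbit_max_perm[OF assms(1)])
qed

text \<open>The two factors of a basis element are kept apart because the normal form of a tensor
  needs both, not only their product.\<close>

definition sym_part :: "monom \<Rightarrow> 'k mpoly"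
  where "sym_part x = elem_sym_power n (rest (exps x))"

definition gen_part :: "monom \<Rightarrow> 'k mpoly"
  where "gen_part x = perm_poly (sorter x) (e (supp (exps x)))"

text \<open>The chosen sorter and \<open>g\<close> differ by an element of the stabiliser of
  \<open>stairs n c\<close>. By \<open>fixes_base\<close> it fixes the leading monomial of the
  generator, so \<open>perm_e_eq\<close> applies.\<close>

lemma gen_part_perm_stairs:
  assumes g: "g permutes {1..n}" and c: "c \<in> monoms n"
  shows "gen_part (perm_monom g (stairs n c)) = perm_poly g (e (supp c))"
proof -
  let ?x = "perm_monom g (stairs n c)"
  have x: "?x \<in> monoms n" using g by (intro perm_monom_in_monoms stairs_in_monoms)
  let ?s = "sorter ?x"
  have s: "?s permutes {1..n}" and eq: "perm_monom ?s (stairs n c) = perm_monom g (stairs n c)"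
    using sorter_props[OF x] by (simp_all add: exps_perm_stairs[OF g c])
  have k: "inv' g \<circ> ?s permutes {1..n}" by (intro permutes_compose permutes_inv g s)
  have b: "bij g" "bij ?s" "bij (inv' g)"
    using g s permutes_bij bij_imp_bij_inv by blast+
  have "perm_monom (inv' g \<circ> ?s) (stairs n c) = stairs n c"
    by (simp add: perm_monom_comp b eq perm_monom_inv)
  from fixes_base[OF k this]
  have "perm_monom (inv' g) (perm_monom ?s (stairs n (base (supp c)))) = stairs n (base (supp c))"
    by (simp add: perm_monom_comp b)
  then have "perm_monom ?s (stairs n (base (supp c))) = perm_monom g (stairs n (base (supp c)))"
    using perm_monom_inv(2)[OF b(1), of "perm_monom ?s (stairs n (base (supp c)))"] by simp
  then have "perm_poly ?s (e (supp c)) = perm_poly g (e (supp c))"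
    using supp_bounds[OF c] s g by (intro perm_e_eq) auto
  then show ?thesis by (simp add: gen_part_def exps_perm_stairs[OF g c])
qed

lemma basis_eq:
  assumes "x \<in> monoms n"
  shows "sym_part x * gen_part x = perm_poly (sorter x) (product (exps x))"
  using sorter_props(1)[OF assms]
  by (simp add: sym_part_def gen_part_def product_def perm_poly_mult perm_elem_sym_power)

lemma basis_in_mpolys:
  assumes "x \<in> monoms n"
  shows "sym_part x * gen_part x \<in> mpolys n"
  unfolding basis_eq[OF assms] product_def
  using supp_bounds[OF exps_props(1)[OF assms]]
  by (intro perm_poly_in_mpolys sorter_props assms mpolys_mult elem_sym_power_in_mpolys e_in_mpolys) auto

lemma unit_basis:
  assumes x: "x \<in> monoms n"
  shows "two_sided_unit (lookup (sym_part x * gen_part x) x)"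
proof -
  have "lookup (sym_part x * gen_part x) x = lookup (product (exps x)) (stairs n (exps x))"
    unfolding basis_eq[OF x]
    using lookup_perm_poly[OF permutes_bij[OF sorter_props(1)[OF x]], of _ "stairs n (exps x)"]
    by (simp only: sorter_props(2)[OF x])
  then show ?thesis
    using unit_e[of "supp (exps x)"] supp_bounds[OF exps_props(1)[OF x]]
    by (simp add: lookup_product[OF exps_props(1)[OF x]] top_e)
qed

lemma basis_lower:
  assumes x: "x \<in> monoms n" and m: "m \<in> keys (sym_part x * gen_part x)" "m \<noteq> x"
  shows "orbit_max n m < orbit_max n x"
proof -
  have s: "sorter x permutes {1..n}" by (rule sorter_props[OF x])
  obtain m' where m': "m = perm_monom (sorter x) m'" "m' \<in> keys (product (exps x))"
    using m(1) unfolding basis_eq[OF x] keys_perm_poly[OF permutes_bij[OF s]] by blast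
  have "m' \<noteq> stairs n (exps x)" using m(2) m'(1) sorter_props(2)[OF x] by auto
  from product_lower[OF exps_props(1)[OF x] m'(2) this] show ?thesis
    by (simp add: m'(1) orbit_max_perm[OF s] exps_props(2)[OF x])
qed

text \<open>The left \<open>k\<close>-linear map sending each monomial to its proposed basis
  element. That these elements form a basis of S is the bijectivity of this map on
  \<open>mpolys n\<close>.\<close>

definition expand :: "'k mpoly \<Rightarrow> 'k mpoly"
  where "expand p = (\<Sum>x\<in>keys p. Const (lookup p x) * (sym_part x * gen_part x))"

lemma expand_superset:
  assumes "finite K" "keys p \<subseteq> K"
  shows "expand p = (\<Sum>x\<in>K. Const (lookup p x) * (sym_part x * gen_part x))"
  unfolding expand_def using assms by (intro sum.mono_neutral_left) (auto simp: in_keys_iff)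

lemma expand_add: "expand (p + q) = expand p + expand q"
proof -
  let ?K = "keys p \<union> keys q"
  have "expand z = (\<Sum>x\<in>?K. Const (lookup z x) * (sym_part x * gen_part x))" if "keys z \<subseteq> ?K" for z
    by (rule expand_superset) (use that in auto)
  from this[of p] this[of q] this[of "p + q"] show ?thesis
    using Poly_Mapping.keys_add[of p q]
    by (simp add: lookup_add Const_add distrib_right sum.distrib)
qed

lemma expand_0 [simp]: "expand 0 = 0"
  by (simp add: expand_def)

lemma expand_sum: "expand (\<Sum>i\<in>I. f i) = (\<Sum>i\<in>I. expand (f i))"
  by (induction I rule: infinite_finite_induct) (auto simp: expand_add)

lemma expand_Const_mult: "expand (Const c * p) = Const c * expand p"
proof -
  have "expand (Const c * p) = (\<Sum>x\<in>keys p. Const (lookup (Const c * p) x) * (sym_part x * gen_part x))"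
    by (intro expand_superset keys_Const_mult) simp
  then show ?thesis
    by (simp add: expand_def lookup_Const_mult Const_mult sum_distrib_left mult.assoc)
qed

lemma expand_single: "expand (single x c) = Const c * (sym_part x * gen_part x)"
  by (subst expand_superset[of "{x}"]) auto

text \<open>Take \<open>x\<close> in \<open>keys p\<close> with the largest orbit. By
  \<open>basis_lower\<close> it occurs in no basis element of another monomial of \<open>p\<close>,
  so its coefficient in \<open>expand p\<close> is its coefficient in \<open>p\<close> times a
  unit.\<close>

lemma expand_eq_0:
  assumes p: "p \<in> mpolys n" and "expand p = 0"
  shows "p = 0"
proof (rule ccontr)
  assume "p \<noteq> 0"
  then have "keys p \<noteq> {}" by (simp add: poly_mapping_eq_iff fun_eq_iff in_keys_iff set_eq_iff) 
  then have "Max (orbit_max n ` keys p) \<in> orbit_max n ` keys p" by (intro Max_in) auto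
  then obtain x where x: "x \<in> keys p" "orbit_max n x = Max (orbit_max n ` keys p)" by auto
  then have max: "orbit_max n y \<le> orbit_max n x" if "y \<in> keys p" for y
    using that by simp
  have mon: "y \<in> monoms n" if "y \<in> keys p" for y using p that by (auto simp: mpolys_iff)
  have "0 = lookup (expand p) x" using assms(2) by simp
  also have "\<dots> = (\<Sum>y\<in>keys p. lookup p y * lookup (sym_part y * gen_part y) x)"
    by (simp add: expand_def lookup_sum lookup_Const_mult)
  also have "\<dots> = (\<Sum>y\<in>keys p. if y = x then lookup p x * lookup (sym_part x * gen_part x) x else 0)"
  proof (rule sum.cong[OF refl])
    fix y assume y: "y \<in> keys p"
    have "x \<notin> keys (sym_part y * gen_part y)" if "y \<noteq> x"
      using basis_lower[OF mon[OF y], of x] max[OF y] that by force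
    then show "lookup p y * lookup (sym_part y * gen_part y) x =
        (if y = x then lookup p x * lookup (sym_part x * gen_part x) x else 0)"
      by (auto simp: in_keys_iff)
  qed
  also have "\<dots> = lookup p x * lookup (sym_part x * gen_part x) x"
    using x(1) by simp
  finally have *: "lookup p x * lookup (sym_part x * gen_part x) x = 0" by simp
  obtain b where "lookup (sym_part x * gen_part x) x * b = 1"
    using unit_basis[OF mon[OF x(1)]] by (auto simp: two_sided_unit_def)
  then have "lookup p x = lookup p x * lookup (sym_part x * gen_part x) x * b"
    by (simp only: mult.assoc mult_1_right)
  then have "lookup p x = 0" by (simp only: * mult_zero_left)
  with x(1) show False by (simp add: in_keys_iff)
qed

text \<open>The basis element of \<open>x\<close> is a unit multiple of \<open>x\<close> plus
  monomials with smaller orbits, which lie in the range by induction on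
  \<open>orbit_max n x\<close>.\<close>

lemma single_in_expand:
  assumes "x \<in> monoms n"
  shows "single x c \<in> expand ` mpolys n"
  using assms
proof (induction x arbitrary: c rule: wf_induct_rule[OF wf_inv_image[OF wf_monoms[of n], of "orbit_max n"]])
  case (1 x)
  let ?R = "expand ` mpolys n" and ?b = "sym_part x * gen_part x"
  have add: "p + q \<in> ?R" if pq: "p \<in> ?R" "q \<in> ?R" for p q
  proof -
    obtain p' q' where "p = expand p'" "q = expand q'" "p' \<in> mpolys n" "q' \<in> mpolys n"
      using pq by blast
    then show ?thesis by (intro image_eqI[of _ _ "p' + q'"]) (simp_all add: expand_add mpolys_add)
  qed
  have scale: "Const a * p \<in> ?R" if p: "p \<in> ?R" for a p
  proof -
    obtain p' where "p = expand p'" "p' \<in> mpolys n" using p by blast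
    then show ?thesis
      by (intro image_eqI[of _ _ "Const a * p'"]) (simp_all add: expand_Const_mult mpolys_mult)
  qed
  \<comment> \<open>Scalars act from the left, so isolating \<open>single x c\<close> takes a left
    inverse here, whereas \<open>expand_eq_0\<close> cancels with a right inverse.\<close>
  obtain u where u: "u * lookup ?b x = 1"
    using unit_basis[OF 1(2)] by (auto simp: two_sided_unit_def)
  let ?r = "?b - single x (lookup ?b x)"
  have keys_r: "m \<in> monoms n \<and> orbit_max n m < orbit_max n x" if m: "m \<in> keys ?r" for m
  proof -
    have "lookup ?r m \<noteq> 0" using m by (simp only: in_keys_iff not_False_eq_True)
    then have "m \<noteq> x" "lookup ?b m \<noteq> 0"
      by (auto simp: lookup_minus lookup_single when_def split: if_splits)
    then have "m \<in> keys ?b" "m \<noteq> x" by (simp_all add: in_keys_iff)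
    then show ?thesis
      using basis_lower[OF 1(2)] basis_in_mpolys[OF 1(2)] by (auto simp: mpolys_iff)
  qed
  have "r \<in> ?R" if "keys r \<subseteq> keys ?r" for r
    using that
  proof (induction r rule: poly_mapping_induct_on)
    case zero
    show ?case by (rule image_eqI[of _ _ 0]) simp_all
  next
    case (single m a)
    then have m: "m \<in> monoms n" "orbit_max n m < orbit_max n x" using keys_r by auto
    show ?case
      by (rule 1(1)) (use m 1(2) in \<open>simp_all add: orbit_max_in_monoms\<close>)
  qed (rule add)
  then have "?r \<in> ?R" by blast
  moreover have "?b \<in> ?R"
    by (rule image_eqI[of _ _ "single x 1"]) (use 1(2) in \<open>simp_all add: expand_single mpolys_iff\<close>)
  \<comment> \<open>Subtraction is written as adding a \<open>Const (- 1)\<close> multiple, because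
    \<open>add\<close> and \<open>scale\<close> are the available closure properties of the
    range.\<close>
  moreover have minus_one: "Const (- 1) = (- 1 :: 'k mpoly)"
    using Const_add[of 1 "- 1 :: 'k"] by (simp add: eq_neg_iff_add_eq_0 add.commute)
  ultimately have "?b + Const (- 1) * ?r \<in> ?R" by (intro add scale)
  then have "Const (c * u) * (?b + Const (- 1) * ?r) \<in> ?R" by (rule scale)
  also have "?b + Const (- 1) * ?r = single x (lookup ?b x)"
  proof -
    have "p + (- 1) * (p - q) = q" for p q :: "'k mpoly" by simp
    then show ?thesis unfolding minus_one .
  qed
  also have "Const (c * u) * single x (lookup ?b x) = single x c"
    by (simp add: Const_def mult_single mult.assoc u)
  finally show ?case .
qed

lemma expand_surj:
  assumes "q \<in> mpolys n"
  obtains p where "p \<in> mpolys n" "expand p = q"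
proof -
  have "keys q \<subseteq> monoms n" using assms by (simp add: mpolys_iff)
  then have "q \<in> expand ` mpolys n"
  proof (induction q rule: poly_mapping_induct_on)
    case zero
    show ?case by (rule image_eqI[of _ _ 0]) simp_all
  next
    case (single m c)
    then show ?case by (rule single_in_expand)
  next
    case (add p q)
    then obtain p' q' where "p = expand p'" "q = expand q'" "p' \<in> mpolys n" "q' \<in> mpolys n" by blast
    then show ?case by (intro image_eqI[of _ _ "p' + q'"]) (simp_all add: expand_add mpolys_add)
  qed
  then show thesis using that by blast
qed

end

section \<open>Tensor products\<close>

text \<open>Right closure of \<open>A\<close> and left closure of \<open>B\<close> keep the
  balancing relations inside the free abelian group; left closure of \<open>A\<close> makes room for
  the action of \<open>k\<close>.\<close>

locale tensor_pair =
  fixes A B :: "'k::ring_1 mpoly set"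
  assumes A_add: "\<And>a a'. a \<in> A \<Longrightarrow> a' \<in> A \<Longrightarrow> a + a' \<in> A"
    and A_zero: "0 \<in> A"
    and A_left: "\<And>a c. a \<in> A \<Longrightarrow> Const c * a \<in> A"
    and A_right: "\<And>a c. a \<in> A \<Longrightarrow> a * Const c \<in> A"
    and B_add: "\<And>b b'. b \<in> B \<Longrightarrow> b' \<in> B \<Longrightarrow> b + b' \<in> B"
    and B_zero: "0 \<in> B"
    and B_left: "\<And>b c. b \<in> B \<Longrightarrow> Const c * b \<in> B"
begin

abbreviation "K \<equiv> tensor_kernel A B"
abbreviation "F \<equiv> free_Abelian_group (A \<times> B)"

lemma relations: "tensor_relations A B \<subseteq> carrier F"
  by (rule tensor_relations_subset) (auto intro: A_add A_right B_add B_left)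

lemma normal_kernel: "normal K F"
proof -
  interpret F: comm_group F by (rule abelian_free_Abelian_group)
  have "subgroup K F"
    unfolding tensor_kernel_def by (rule F.generate_is_subgroup[OF relations])
  then show ?thesis by (rule F.subgroup_imp_normal)
qed

lemma kernel_subset: "u \<in> K \<Longrightarrow> keys u \<subseteq> A \<times> B"
  using subsetD[OF subgroup.subset[OF normal.axioms(1)[OF normal_kernel]], of u] by simp

lemma kernel_zero [simp]: "0 \<in> K"
  using normal.axioms(1)[OF normal_kernel, THEN subgroup.one_closed] by simp

lemma kernel_add: "u \<in> K \<Longrightarrow> v \<in> K \<Longrightarrow> u + v \<in> K"
  using normal.axioms(1)[OF normal_kernel, THEN subgroup.m_closed] by simp

lemma kernel_uminus: "u \<in> K \<Longrightarrow> - u \<in> K"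
  using normal.axioms(1)[OF normal_kernel, THEN subgroup.m_inv_closed, of u] kernel_subset[of u] by simp

lemma kernel_diff: "u \<in> K \<Longrightarrow> v \<in> K \<Longrightarrow> u - v \<in> K"
  using kernel_add[of u "- v"] kernel_uminus[of v] by simp

lemma kernel_sum: "(\<And>i. i \<in> I \<Longrightarrow> f i \<in> K) \<Longrightarrow> (\<Sum>i\<in>I. f i) \<in> K"
  by (induction I rule: infinite_finite_induct) (auto simp: kernel_add)

lemma kernel_trans: "u - v \<in> K \<Longrightarrow> v - w \<in> K \<Longrightarrow> u - w \<in> K"
  using kernel_add[of "u - v" "v - w"] by simp

lemma kernel_relations: "u \<in> tensor_relations A B \<Longrightarrow> u \<in> K"
  unfolding tensor_kernel_def by (rule generate.incl)

text \<open>The additivity relation for 0 + 0 collapses to \<open>- frag_of (0, b)\<close>.\<close>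

lemma kernel_zero_left: "b \<in> B \<Longrightarrow> frag_of (0, b) \<in> K"
  using kernel_uminus[OF kernel_relations[OF tensor_relationsI(1)[OF A_zero A_zero]]] by simp

lemma kernel_zero_right: "a \<in> A \<Longrightarrow> frag_of (a, 0) \<in> K"
  using kernel_uminus[OF kernel_relations[OF tensor_relationsI(2)[OF _ B_zero B_zero]]] by simp

lemma B_sum: "(\<And>i. i \<in> I \<Longrightarrow> f i \<in> B) \<Longrightarrow> (\<Sum>i\<in>I. f i) \<in> B"
  by (induction I rule: infinite_finite_induct) (auto simp: B_add B_zero)

lemma A_sum: "(\<And>i. i \<in> I \<Longrightarrow> f i \<in> A) \<Longrightarrow> (\<Sum>i\<in>I. f i) \<in> A"
  by (induction I rule: infinite_finite_induct) (auto simp: A_add A_zero)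

lemma kernel_sum_left:
  assumes "b \<in> B" "finite I" "\<And>i. i \<in> I \<Longrightarrow> f i \<in> A"
  shows "frag_of (\<Sum>i\<in>I. f i, b) - (\<Sum>i\<in>I. frag_of (f i, b)) \<in> K"
  using assms(2,3)
proof (induction I rule: finite_induct)
  case (insert i I)
  have "frag_of (f i + sum f I, b) - frag_of (f i, b) - frag_of (sum f I, b) \<in> K"
    using insert assms(1) by (intro kernel_relations tensor_relationsI A_sum) auto
  from kernel_add[OF this insert.IH] show ?case
    using insert by (simp add: algebra_simps)
qed (simp add: kernel_zero_left assms)

lemma kernel_sum_right:
  assumes "a \<in> A" "finite I" "\<And>i. i \<in> I \<Longrightarrow> f i \<in> B"
  shows "frag_of (a, \<Sum>i\<in>I. f i) - (\<Sum>i\<in>I. frag_of (a, f i)) \<in> K"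
  using assms(2,3)
proof (induction I rule: finite_induct)
  case (insert i I)
  have "frag_of (a, f i + sum f I) - frag_of (a, f i) - frag_of (a, sum f I) \<in> K"
    using insert assms(1) by (intro kernel_relations tensor_relationsI B_sum) auto
  from kernel_add[OF this insert.IH] show ?case
    using insert by (simp add: algebra_simps)
qed (simp add: kernel_zero_right assms)

lemma tensor_class_image: "tensor_class A B u = (\<lambda>h. h + u) ` K"
  by (auto simp: tensor_class_def r_coset_def)

lemma tensor_class_eqI:
  assumes "u - v \<in> K"
  shows "tensor_class A B u = tensor_class A B v"
  unfolding tensor_class_image
proof (intro equalityI image_subsetI)
  fix h assume "h \<in> K"
  then show "h + u \<in> (\<lambda>h. h + v) ` K"
    using kernel_add[OF _ assms] by (intro image_eqI[of _ _ "h + (u - v)"]) auto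
  show "h + v \<in> (\<lambda>h. h + u) ` K"
    using kernel_diff[OF \<open>h \<in> K\<close> assms] by (intro image_eqI[of _ _ "h - (u - v)"]) auto
qed

lemma carrier_tensor_group:
  "carrier (tensor_group A B) = {tensor_class A B u | u. keys u \<subseteq> A \<times> B}"
  by (auto simp: tensor_group_def FactGroup_def RCOSETS_def tensor_class_def)

lemma tensor_class_in_carrier: "keys u \<subseteq> A \<times> B \<Longrightarrow> tensor_class A B u \<in> carrier (tensor_group A B)"
  by (auto simp: carrier_tensor_group)

lemma tensor_group_mult:
  assumes "keys u \<subseteq> A \<times> B" "keys v \<subseteq> A \<times> B"
  shows "tensor_class A B u \<otimes>\<^bsub>tensor_group A B\<^esub> tensor_class A B v = tensor_class A B (u + v)"
  using normal.rcos_sum[OF normal_kernel, of u v] assms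
  by (simp add: tensor_group_def FactGroup_def tensor_class_def)

lemma comm_group_tensor_group: "comm_group (tensor_group A B)"
proof (rule group.group_comm_groupI)
  show "group (tensor_group A B)"
    unfolding tensor_group_def by (rule normal.factorgroup_is_group[OF normal_kernel])
  fix x y assume "x \<in> carrier (tensor_group A B)" "y \<in> carrier (tensor_group A B)"
  then show "x \<otimes>\<^bsub>tensor_group A B\<^esub> y = y \<otimes>\<^bsub>tensor_group A B\<^esub> x"
    by (auto simp: carrier_tensor_group tensor_group_mult add.commute)
qed

lemma comm_group_tensor_module: "comm_group (add_monoid (tensor_module A B))"
proof -
  interpret T: comm_group "tensor_group A B" by (rule comm_group_tensor_group)
  show ?thesis
    by (rule comm_groupI)
      (simp_all add: tensor_module_def T.m_ac bexI[of _ "inv\<^bsub>tensor_group A B\<^esub> _"])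
qed

lemma keys_tensor_act:
  assumes "keys u \<subseteq> A \<times> B" and B: "\<And>b g. b \<in> B \<Longrightarrow> g \<in> keys r \<Longrightarrow> perm_poly g b \<in> B"
  shows "keys (tensor_act r u) \<subseteq> A \<times> B"
  unfolding tensor_act_def
proof (rule order_trans[OF keys_frag_extend], rule UN_least)
  fix x assume "x \<in> keys u"
  then obtain a b where x: "x = (a, b)" "a \<in> A" "b \<in> B" using assms(1) by blast
  show "keys (case x of (a, b) \<Rightarrow> \<Sum>g\<in>keys r. frag_of (Const (lookup r g) * a, perm_poly g b)) \<subseteq> A \<times> B"
    unfolding x prod.case
    by (rule order_trans[OF keys_sum]) (use x in \<open>auto simp: keys_frag_of A_left B\<close>)
qed

text \<open>The action moves only the second factor of a tensor. As the first factors are invariant,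
  this is the same as moving the whole product.\<close>

lemma eval_product_tensor_act:
  assumes "keys u \<subseteq> A \<times> B" and A: "\<And>a g. a \<in> A \<Longrightarrow> g \<in> keys r \<Longrightarrow> perm_poly g a = a"
  shows "eval_product (tensor_act r u) = poly_act r (eval_product u)"
  using assms(1)
proof (induction u rule: frag_induction)
  case zero
  then show ?case by (simp add: tensor_act_def)
next
  case (one x)
  obtain a b where x: "x = (a, b)" "a \<in> A" "b \<in> B" using one by blast
  have sum: "eval_product (\<Sum>g\<in>L. f g) = (\<Sum>g\<in>L. eval_product (f g))" for L and f :: "(nat \<Rightarrow> nat) \<Rightarrow> _"
    by (induction L rule: infinite_finite_induct) (auto simp: eval_product_add)
  have "eval_product (tensor_act r (frag_of x)) =
      (\<Sum>g\<in>keys r. Const (lookup r g) * a * perm_poly g b)"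
    by (simp add: x tensor_act_def sum)
  also have "\<dots> = poly_act r (a * b)"
    unfolding poly_act_def using x A by (intro sum.cong) (simp_all add: perm_poly_mult mult.assoc)
  finally show ?case by (simp add: x)
next
  case (diff u v)
  have "poly_act r (p - q) = poly_act r p - poly_act r q" for p q
    using poly_act_add_right[of r "p - q" q] by simp
  with diff show ?case by (simp add: tensor_act_diff eval_product_diff)
qed

end

section \<open>The coefficient rings\<close>

lemma elem_sym_subring_intros:
  shows "Const c \<in> elem_sym_subring n I"
    and "i \<in> I \<Longrightarrow> elem_sym n i \<in> elem_sym_subring n I"
    and "p \<in> elem_sym_subring n I \<Longrightarrow> q \<in> elem_sym_subring n I \<Longrightarrow> p + q \<in> elem_sym_subring n I"
    and "p \<in> elem_sym_subring n I \<Longrightarrow> q \<in> elem_sym_subring n I \<Longrightarrow> p * q \<in> elem_sym_subring n I"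
  unfolding elem_sym_subring_def
  using generate_ring.eng_add[of p "poly_module n" _ q] generate_ring.eng_mult[of p "poly_module n" _ q]
  by (auto intro: generate_ring.incl)

lemma one_in_elem_sym_subring: "1 \<in> elem_sym_subring n I"
  using elem_sym_subring_intros(1)[of 1] by simp

lemma elem_sym_power_in_subring:
  assumes "keys a \<subseteq> I"
  shows "elem_sym_power n a \<in> elem_sym_subring n I"
proof -
  have "elem_sym n i ^ lookup a i \<in> elem_sym_subring n I" for i
  proof (cases "i \<in> I")
    case True
    then show ?thesis
      by (intro power_closed elem_sym_subring_intros one_in_elem_sym_subring)
  next
    case False
    then have "lookup a i = 0" using assms by (auto simp: in_keys_iff)
    then show ?thesis by (simp add: one_in_elem_sym_subring)
  qed
  then show ?thesis
    unfolding elem_sym_power_def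
    by (intro prod_list_closed elem_sym_subring_intros one_in_elem_sym_subring) auto
qed

text \<open>Substitutes the d_i for the variables of \<open>q\<close>. Coefficients stand on the
  right, from where a balancing relation moves them across the tensor sign.\<close>

definition elem_sym_poly :: "nat \<Rightarrow> (monom \<Rightarrow>\<^sub>0 'k::ring_1) \<Rightarrow> 'k mpoly"
  where "elem_sym_poly n q = (\<Sum>a\<in>keys q. elem_sym_power n a * Const (lookup q a))"

lemma elem_sym_poly_superset:
  assumes "finite L" "keys q \<subseteq> L"
  shows "elem_sym_poly n q = (\<Sum>a\<in>L. elem_sym_power n a * Const (lookup q a))"
  unfolding elem_sym_poly_def using assms by (intro sum.mono_neutral_left) (auto simp: in_keys_iff)

lemma elem_sym_poly_single: "elem_sym_poly n (single a c) = elem_sym_power n a * Const c"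
  by (subst elem_sym_poly_superset[of "{a}"]) auto

lemma elem_sym_poly_0 [simp]: "elem_sym_poly n 0 = 0"
  by (simp add: elem_sym_poly_def)

lemma elem_sym_poly_add: "elem_sym_poly n (p + q) = elem_sym_poly n p + elem_sym_poly n q"
proof -
  let ?L = "keys p \<union> keys q"
  have "elem_sym_poly n z = (\<Sum>a\<in>?L. elem_sym_power n a * Const (lookup z a))" if "keys z \<subseteq> ?L" for z
    by (rule elem_sym_poly_superset) (use that in auto)
  from this[of p] this[of q] this[of "p + q"] show ?thesis
    using Poly_Mapping.keys_add[of p q]
    by (simp add: lookup_add Const_add distrib_left sum.distrib)
qed

text \<open>Power products are central, so they can be collected on the left while the coefficients
  keep their order.\<close>

lemma elem_sym_poly_mult: "elem_sym_poly n (p * q) = elem_sym_poly n p * elem_sym_poly n q"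
proof (induction p rule: poly_mapping_induct)
  case (single a c)
  show ?case
  proof (induction q rule: poly_mapping_induct)
    case (single b d)
    have "elem_sym_power n (a + b) * Const (c * d) =
        elem_sym_power n a * (elem_sym_power n b * Const c) * Const d"
      by (simp add: elem_sym_power_add Const_mult mult.assoc)
    also have "\<dots> = elem_sym_power n a * Const c * (elem_sym_power n b * Const d)"
      by (simp add: elem_sym_power_commute[of n b] mult.assoc)
    finally show ?case by (simp add: mult_single elem_sym_poly_single)
  qed (simp add: distrib_left elem_sym_poly_add)
qed (simp add: distrib_right elem_sym_poly_add)

lemma elem_sym_subring_subset:
  assumes "I \<subseteq> {1..n}" "p \<in> elem_sym_subring n I"
  obtains q where "\<And>a. a \<in> keys q \<Longrightarrow> keys a \<subseteq> I" "p = elem_sym_poly n q"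
proof -
  let ?S = "{a. keys a \<subseteq> I}"
  \<comment> \<open>Membership in \<open>mpolys n\<close> is carried along because
    \<open>uminus_poly_module\<close> identifies the ring's additive inverse with \<open>-\<close>
    only there.\<close>
  have "\<exists>q. keys q \<subseteq> ?S \<and> p = elem_sym_poly n q \<and> p \<in> mpolys n"
    using assms(2) unfolding elem_sym_subring_def
  proof (induction p rule: generate_ring.induct)
    case one
    then show ?case
      using elem_sym_poly_single[of n 0 1] by (intro exI[of _ "single 0 1"]) simp
  next
    case (incl h)
    then show ?case
    proof
      assume "h \<in> range Const"
      then obtain c where "h = Const c" by blast
      then show ?case
        by (intro exI[of _ "single 0 c"]) (simp add: elem_sym_poly_single)
    next
      assume "h \<in> elem_sym n ` I"
      then obtain i where "i \<in> I" "h = elem_sym n i" by blast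
      moreover from this have "elem_sym_power n (single i 1) = (elem_sym n i :: 'a mpoly)"
        using assms(1) by (intro elem_sym_power_single) auto
      ultimately show ?case
        by (intro exI[of _ "single (single i 1) 1"]) (simp add: elem_sym_poly_single elem_sym_in_mpolys)
    qed
  next
    case (a_inv h)
    then obtain q where q: "keys q \<subseteq> ?S" "h = elem_sym_poly n q" "h \<in> mpolys n" by blast
    have "elem_sym_poly n (- q) = - elem_sym_poly n q"
      using elem_sym_poly_add[of n q "- q"]
      by (simp add: eq_neg_iff_add_eq_0 add.commute)
    moreover have "- h \<in> mpolys n" using mpolys_diff[of 0 n h] q by simp
    moreover have "keys (- q) = keys q" by (auto simp: in_keys_iff)
    ultimately show ?case using q by (intro exI[of _ "- q"]) (simp add: uminus_poly_module)
  next
    case (eng_add h1 h2)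
    then obtain q1 q2 where "keys q1 \<subseteq> ?S" "h1 = elem_sym_poly n q1" "h1 \<in> mpolys n"
      "keys q2 \<subseteq> ?S" "h2 = elem_sym_poly n q2" "h2 \<in> mpolys n" by blast
    then show ?case
      by (intro exI[of _ "q1 + q2"] conjI keys_add_subset) (simp_all add: elem_sym_poly_add mpolys_add)
  next
    case (eng_mult h1 h2)
    then obtain q1 q2 where q: "keys q1 \<subseteq> ?S" "h1 = elem_sym_poly n q1" "h1 \<in> mpolys n"
      "keys q2 \<subseteq> ?S" "h2 = elem_sym_poly n q2" "h2 \<in> mpolys n" by blast
    have "keys (q1 * q2) \<subseteq> ?S"
    proof
      fix a assume "a \<in> keys (q1 * q2)"
      then obtain k l where kl: "a = k + l" "k \<in> keys q1" "l \<in> keys q2"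
        using Poly_Mapping.keys_mult[of q1 q2] by blast
      then show "a \<in> ?S" using q keys_add_subset[of k I l] by blast
    qed
    then show ?case
      using q by (intro exI[of _ "q1 * q2"]) (simp add: elem_sym_poly_mult mpolys_mult)
  qed
  then show thesis using that by blast
qed

lemma perm_elem_sym_subring:
  assumes "I \<subseteq> {1..n}" "p \<in> elem_sym_subring n I" "g permutes {1..n}"
  shows "perm_poly g p = p"
proof -
  obtain q where "p = elem_sym_poly n q" using elem_sym_subring_subset[OF assms(1,2)] by metis
  then show ?thesis
    by (simp add: elem_sym_poly_def perm_poly_sum perm_poly_mult perm_elem_sym_power[OF assms(3)])
qed

lemma elem_sym_subring_in_mpolys:
  assumes "I \<subseteq> {1..n}" "p \<in> elem_sym_subring n I"
  shows "p \<in> mpolys n"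
proof -
  obtain q where "p = elem_sym_poly n q" using elem_sym_subring_subset[OF assms(1,2)] by metis
  then show ?thesis
    unfolding elem_sym_poly_def by (simp add: mpolys_sum mpolys_mult elem_sym_power_in_mpolys)
qed

section \<open>Cyclic submodules\<close>

lemma cyclic_submodule_iff:
  "v \<in> cyclic_submodule n p \<longleftrightarrow> (\<exists>r. keys r \<subseteq> {g. g permutes {1..n}} \<and> v = poly_act r p)"
  by (auto simp: cyclic_submodule_def)

lemma cyclic_submodule_add:
  assumes "v \<in> cyclic_submodule n p" "w \<in> cyclic_submodule n p"
  shows "v + w \<in> cyclic_submodule n p"
proof -
  obtain r s where rs: "keys r \<subseteq> {g. g permutes {1..n}}" "v = poly_act r p"
    "keys s \<subseteq> {g. g permutes {1..n}}" "w = poly_act s p"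
    using assms unfolding cyclic_submodule_iff by blast
  then show ?thesis
    unfolding cyclic_submodule_iff
    by (intro exI[of _ "r + s"] conjI keys_add_subset) (simp_all add: poly_act_add_left)
qed

lemma zero_in_cyclic_submodule: "0 \<in> cyclic_submodule n p"
  unfolding cyclic_submodule_iff by (intro exI[of _ 0]) simp

lemma poly_act_cyclic_submodule:
  assumes "keys s \<subseteq> {g. g permutes {1..n}}" "v \<in> cyclic_submodule n p"
  shows "poly_act s v \<in> cyclic_submodule n p"
proof -
  obtain r where r: "keys r \<subseteq> {g. g permutes {1..n}}" "v = poly_act r p"
    using assms(2) unfolding cyclic_submodule_iff by blast
  have "keys (s \<otimes>\<^bsub>kG n\<^esub> r) \<subseteq> {g. g permutes {1..n}}"
    using group_ring_mult_closed[OF sym_group_is_group, of s n r] assms(1) r(1) by simp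
  then show ?thesis
    unfolding cyclic_submodule_iff using assms(1) r
    by (intro exI[of _ "s \<otimes>\<^bsub>kG n\<^esub> r"]) (simp add: poly_act_mult)
qed

lemma Const_mult_cyclic_submodule:
  assumes "v \<in> cyclic_submodule n p"
  shows "Const c * v \<in> cyclic_submodule n p"
  using poly_act_cyclic_submodule[of "single id c" n v p] assms permutes_id[of "{1..n}"]
  by (cases "c = 0") (simp_all add: zero_in_cyclic_submodule)

lemma perm_poly_cyclic_submodule:
  assumes "v \<in> cyclic_submodule n p" "g permutes {1..n}"
  shows "perm_poly g v \<in> cyclic_submodule n p"
  using poly_act_cyclic_submodule[of "single g 1" n v p] assms by simp

lemma generator_in_cyclic_submodule: "p \<in> cyclic_submodule n p"
  unfolding cyclic_submodule_iff using permutes_id[of "{1..n}"]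
  by (intro exI[of _ "single id 1"]) simp

lemma cyclic_submodule_in_mpolys:
  "p \<in> mpolys n \<Longrightarrow> v \<in> cyclic_submodule n p \<Longrightarrow> v \<in> mpolys n"
  unfolding cyclic_submodule_iff using poly_act_in_mpolys[of _ n p] by auto

lemma submodule_poly_moduleI:
  assumes "N \<subseteq> mpolys n" "0 \<in> N" "\<And>v w. v \<in> N \<Longrightarrow> w \<in> N \<Longrightarrow> v + w \<in> N"
    and "\<And>r v. keys r \<subseteq> {g. g permutes {1..n}} \<Longrightarrow> v \<in> N \<Longrightarrow> poly_act r v \<in> N"
  shows "submodule N (kG n) (poly_module n)"
proof (rule submodule.intro)
  show "subgroup N (add_monoid (poly_module n))"
  proof
    fix v assume v: "v \<in> N"
    \<comment> \<open>Additive inverses come from the action of minus the identity of the group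
      ring.\<close>
    have "keys (single id (- 1 :: 'a)) \<subseteq> {g. g permutes {1..n}}"
      using permutes_id[of "{1..n}"] by simp
    moreover have "Const (- 1) = (- 1 :: 'a mpoly)"
      using Const_add[of 1 "- 1 :: 'a"] by (simp add: eq_neg_iff_add_eq_0 add.commute)
    ultimately have "- v \<in> N" using assms(4)[OF _ v] by fastforce
    then show "inv\<^bsub>add_monoid (poly_module n)\<^esub> v \<in> N"
      using uminus_poly_module[of v n] v assms(1) by (auto simp: a_inv_def)
  qed (use assms in auto)
  show "submodule_axioms N (kG n) (poly_module n)"
    by unfold_locales (simp add: assms(4))
qed

lemma fin_gen_cyclic_submodule:
  assumes "p \<in> mpolys n"
  shows "fin_gen_submodule (kG n) (poly_module n) (cyclic_submodule n p)"
proof -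
  have sub: "submodule (cyclic_submodule n p) (kG n) (poly_module n)"
    using cyclic_submodule_in_mpolys[OF assms]
    by (intro submodule_poly_moduleI zero_in_cyclic_submodule cyclic_submodule_add poly_act_cyclic_submodule) auto
  have "cyclic_submodule n p \<subseteq> H" if "submodule H (kG n) (poly_module n)" "p \<in> H" for H
    using submodule.smult_closed[OF that(1) _ that(2)] by (auto simp: cyclic_submodule_iff)
  then have "cyclic_submodule n p = \<Inter>{H. submodule H (kG n) (poly_module n) \<and> {p} \<subseteq> H}"
    using sub generator_in_cyclic_submodule[of p n] by blast
  then show ?thesis
    unfolding fin_gen_submodule_def
    using sub generator_in_cyclic_submodule[of p n] by (intro conjI exI[of _ "{p}"]) simp_all
qed

lemma fin_gen_zero_submodule:
  "fin_gen_submodule (kG n) (poly_module n) {0 :: 'k::ring_1 mpoly}"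
proof -
  have sub: "submodule {0 :: 'k mpoly} (kG n) (poly_module n)"
    by (rule submodule_poly_moduleI) auto
  have "0 \<in> H" if "submodule H (kG n) (poly_module n)" for H :: "'k mpoly set"
    using submodule.axioms(1)[OF that, THEN subgroup.one_closed] by simp
  then have "{0 :: 'k mpoly} = \<Inter>{H. submodule H (kG n) (poly_module n) \<and> {} \<subseteq> H}"
    using sub by blast
  then show ?thesis
    unfolding fin_gen_submodule_def using sub by (intro conjI exI[of _ "{}"]) simp_all
qed

context leading_generators
begin

section \<open>Normal forms of tensors\<close>

text \<open>Indexes the basis elements that belong to the summand of \<open>I\<close>; the blocks
  partition \<open>monoms n\<close>.\<close>

definition block :: "nat set \<Rightarrow> monom set"
  where "block I = {x \<in> monoms n. supp (exps x) = I}"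

text \<open>A lift of \<open>expand p\<close> to formal sums of pairs. It is additive only modulo
  the tensor relations.\<close>

definition rep :: "'k mpoly \<Rightarrow> ('k mpoly \<times> 'k mpoly \<Rightarrow>\<^sub>0 int)"
  where "rep p = (\<Sum>x\<in>keys p. frag_of (sym_part x, Const (lookup p x) * gen_part x))"

lemma block_empty: "n \<notin> I \<Longrightarrow> block I = {}"
  by (auto simp: block_def supp_def)

lemma rep_0 [simp]: "rep 0 = 0"
  by (simp add: rep_def)

lemma eval_product_rep: "eval_product (rep p) = expand p"
proof -
  have sum: "eval_product (\<Sum>x\<in>L. f x) = (\<Sum>x\<in>L. eval_product (f x))"
    for L and f :: "monom \<Rightarrow> ('k mpoly \<times> 'k mpoly \<Rightarrow>\<^sub>0 int)"
    by (induction L rule: infinite_finite_induct) (auto simp: eval_product_add)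
  have "sym_part x * (Const c * gen_part x) = Const c * (sym_part x * gen_part x)" for x c
    unfolding sym_part_def by (simp only: mult.assoc[symmetric] elem_sym_power_commute[of n _ "Const c"])
  then show ?thesis by (simp add: rep_def expand_def sum)
qed

lemma tensor_pair_subring:
  assumes "B = cyclic_submodule n p \<or> B = {0}"
  shows "tensor_pair (elem_sym_subring n I) B"
proof
  show "0 \<in> elem_sym_subring n I" for I
    using elem_sym_subring_intros(1)[of 0 n I] by simp
  show "b + b' \<in> B" if "b \<in> B" "b' \<in> B" for b b'
    using assms that cyclic_submodule_add by auto
  show "Const c * b \<in> B" if "b \<in> B" for b c
    using assms that Const_mult_cyclic_submodule by auto
  show "0 \<in> B" using assms zero_in_cyclic_submodule by auto
qed (auto intro: elem_sym_subring_intros)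

lemma parts_closed:
  assumes "x \<in> block I"
  shows "sym_part x \<in> elem_sym_subring n I" "gen_part x \<in> cyclic_submodule n (e I)"
proof -
  have x: "x \<in> monoms n" and I: "supp (exps x) = I" using assms by (auto simp: block_def)
  show "sym_part x \<in> elem_sym_subring n I"
    unfolding sym_part_def using keys_rest[of "exps x"] I by (intro elem_sym_power_in_subring) simp
  show "gen_part x \<in> cyclic_submodule n (e I)"
    unfolding gen_part_def I
    by (intro perm_poly_cyclic_submodule generator_in_cyclic_submodule sorter_props x)
qed

lemma keys_rep:
  assumes "keys p \<subseteq> block I" and B: "n \<in> I \<Longrightarrow> B = cyclic_submodule n (e I)"
  shows "keys (rep p) \<subseteq> elem_sym_subring n I \<times> B"
proof (cases "n \<in> I")
  case True
  have "keys (frag_of (sym_part x, Const (lookup p x) * gen_part x)) \<subseteq> elem_sym_subring n I \<times> B"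
    if "x \<in> keys p" for x
    using parts_closed[OF subsetD[OF assms(1) that]]
    by (simp add: keys_frag_of B[OF True] Const_mult_cyclic_submodule)
  then show ?thesis
    unfolding rep_def by (intro order_trans[OF keys_sum] UN_least)
next
  case False
  then have "keys p = {}" using assms(1) block_empty by blast
  then show ?thesis by (simp add: rep_def)
qed

text \<open>Formal sums congruent to a normal form are closed under differences, so a single pair
  suffices. Its entries split into power products with coefficients and scaled translates of
  \<open>e I\<close>, and such a pair is congruent to a multiple of one basis tensor.\<close>

lemma rep_spans_cyclic:
  assumes I: "{n} \<subseteq> I" "I \<subseteq> {1..n}"
    and u: "keys u \<subseteq> elem_sym_subring n I \<times> cyclic_submodule n (e I)"
  obtains p where "keys p \<subseteq> block I"
    "u - rep p \<in> tensor_kernel (elem_sym_subring n I) (cyclic_submodule n (e I))"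
proof -
  let ?A = "elem_sym_subring n I" and ?B = "cyclic_submodule n (e I)"
  interpret tensor_pair ?A ?B by (rule tensor_pair_subring[of _ "e I"]) simp
  define term_of where "term_of p x = frag_of (sym_part x, Const (lookup p x) * gen_part x)" for p x
  \<comment> \<open>Terms outside \<open>keys p\<close> have second entry 0; they are nonzero in the
    free abelian group but lie in \<open>K\<close>.\<close>
  have rep_superset: "(\<Sum>x\<in>L. term_of p x) - rep p \<in> K"
    if L: "finite L" "keys p \<subseteq> L" "L \<subseteq> block I" for L p
  proof -
    have "(\<Sum>x\<in>L. term_of p x) - rep p = (\<Sum>x\<in>L - keys p. term_of p x)"
      unfolding rep_def term_of_def[symmetric] using L by (simp add: sum_diff)
    also have "\<dots> \<in> K"
    proof (rule kernel_sum)
      fix x assume "x \<in> L - keys p"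
      then show "term_of p x \<in> K"
        using parts_closed[of x I] L(3) kernel_zero_right[of "sym_part x"]
        by (auto simp: term_of_def in_keys_iff)
    qed
    finally show ?thesis .
  qed
  have rep_add: "rep (p + q) - (rep p + rep q) \<in> K" if pq: "keys p \<subseteq> block I" "keys q \<subseteq> block I" for p q
  proof -
    let ?L = "keys p \<union> keys q"
    have "(\<Sum>x\<in>?L. term_of (p + q) x - term_of p x - term_of q x) \<in> K"
    proof (rule kernel_sum)
      fix x assume "x \<in> ?L"
      then have "x \<in> block I" using pq by blast
      from parts_closed[OF this] show "term_of (p + q) x - term_of p x - term_of q x \<in> K"
        unfolding term_of_def lookup_add Const_add distrib_right
        by (intro kernel_relations tensor_relationsI Const_mult_cyclic_submodule)
    qed
    then have *: "(\<Sum>x\<in>?L. term_of (p + q) x) - (\<Sum>x\<in>?L. term_of p x) - (\<Sum>x\<in>?L. term_of q x) \<in> K"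
      by (simp only: sum_subtractf)
    have sup: "(\<Sum>x\<in>?L. term_of z x) - rep z \<in> K" if "keys z \<subseteq> ?L" for z
      using rep_superset[of ?L z] that pq by simp
    have "keys (p + q) \<subseteq> ?L" by (rule Poly_Mapping.keys_add)
    from kernel_diff[OF kernel_add[OF kernel_add[OF * sup[of p]] sup[of q]] sup[OF this]] show ?thesis
      by (simp add: algebra_simps)
  qed
  define U where "U = {u. \<exists>p. keys p \<subseteq> block I \<and> u - rep p \<in> K}"
  have U_add: "u + v \<in> U" if uv: "u \<in> U" "v \<in> U" for u v
  proof -
    obtain p q where p: "keys p \<subseteq> block I" "u - rep p \<in> K" and q: "keys q \<subseteq> block I" "v - rep q \<in> K"
      using uv by (auto simp: U_def)
    have "u + v - rep (p + q) \<in> K"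
      using kernel_diff[OF kernel_add[OF p(2) q(2)] rep_add[OF p(1) q(1)]] by (simp add: algebra_simps)
    then show ?thesis using keys_add_subset[OF p(1) q(1)] by (auto simp: U_def)
  qed
  have U_diff: "u - v \<in> U" if uv: "u \<in> U" "v \<in> U" for u v
  proof -
    obtain p q where p: "keys p \<subseteq> block I" "u - rep p \<in> K" and q: "keys q \<subseteq> block I" "v - rep q \<in> K"
      using uv by (auto simp: U_def)
    have pq: "keys (p - q) \<subseteq> block I" using keys_diff[of p q] p(1) q(1) by blast
    \<comment> \<open>Additivity is applied to \<open>p - q\<close> and \<open>q\<close>, whose sum
      is \<open>p\<close>.\<close>
    have "u - v - rep (p - q) \<in> K"
      using kernel_add[OF kernel_diff[OF p(2) q(2)] rep_add[OF pq q(1)]] by (simp add: algebra_simps)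
    then show ?thesis using pq by (auto simp: U_def)
  qed
  have U_0: "0 \<in> U" by (auto simp: U_def intro: exI[of _ 0])
  have U_sum: "(\<Sum>i\<in>L. f i) \<in> U" if "\<And>i. i \<in> L \<Longrightarrow> f i \<in> U" for L and f :: "'i \<Rightarrow> _"
    using that by (induction L rule: infinite_finite_induct) (auto simp: U_0 U_add)
  have U_cong: "u \<in> U" if uv: "u - v \<in> K" "v \<in> U" for u v
  proof -
    obtain p where p: "keys p \<subseteq> block I" "v - rep p \<in> K" using uv(2) by (auto simp: U_def)
    then show ?thesis using kernel_trans[OF uv(1) p(2)] by (auto simp: U_def)
  qed
  have basic: "frag_of (elem_sym_power n a * Const c, Const d * perm_poly g (e I)) \<in> U"
    if a: "keys a \<subseteq> I" and g: "g permutes {1..n}" for a c d g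
  proof -
    \<comment> \<open>The vector with \<open>supp ?k = I\<close> and \<open>rest ?k = a\<close>; its
      stairs, moved by \<open>g\<close>, give the monomial whose basis element has exactly these two
      factors.\<close>
    let ?k = "a + base I"
    have fin: "finite I" using I finite_subset by blast
    have k: "?k \<in> monoms n"
      using a I keys_base[OF fin] by (intro monoms_add) (auto simp: monoms_def)
    define x where "x = perm_monom g (stairs n ?k)"
    have ex: "exps x = ?k" unfolding x_def by (rule exps_perm_stairs[OF g k])
    have s: "supp ?k = I" "rest ?k = a" using supp_add_base[OF a _ fin] I by auto
    have parts: "sym_part x = elem_sym_power n a" "gen_part x = perm_poly g (e I)"
      using gen_part_perm_stairs[OF g k] by (simp_all add: sym_part_def ex s) (simp add: x_def)
    have x: "x \<in> block I"
      by (simp add: block_def ex s) (simp add: x_def perm_monom_in_monoms[OF g] stairs_in_monoms)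
    \<comment> \<open>Balancing moves \<open>c\<close> to the second entry, where it merges with
      \<open>d\<close>.\<close>
    have "frag_of (sym_part x * Const c, Const d * gen_part x) - frag_of (sym_part x, Const c * (Const d * gen_part x)) \<in> K"
      by (intro kernel_relations tensor_relationsI Const_mult_cyclic_submodule parts_closed[OF x])
    moreover have "frag_of (sym_part x, Const c * (Const d * gen_part x)) - rep (single x (c * d)) \<in> K"
      using rep_superset[of "{x}" "single x (c * d)"] x
      by (simp add: term_of_def Const_mult mult.assoc)
    ultimately have "frag_of (sym_part x * Const c, Const d * gen_part x) - rep (single x (c * d)) \<in> K"
      by (rule kernel_trans)
    then show ?thesis
      unfolding U_def parts using x by (intro CollectI exI[of _ "single x (c * d)"]) simp
  qed
  have pure: "frag_of (a, b) \<in> U" if a: "a \<in> ?A" and b: "b \<in> ?B" for a b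
  proof -
    obtain q where q: "\<And>m. m \<in> keys q \<Longrightarrow> keys m \<subseteq> I" "a = elem_sym_poly n q"
      using elem_sym_subring_subset[OF I(2) a] by metis
    obtain r where r: "keys r \<subseteq> {g. g permutes {1..n}}" "b = poly_act r (e I)"
      using b by (auto simp: cyclic_submodule_iff)
    let ?s = "\<lambda>m. elem_sym_power n m * Const (lookup q m)"
    let ?t = "\<lambda>g. Const (lookup r g) * perm_poly g (e I)"
    have s: "?s m \<in> ?A" if "m \<in> keys q" for m
      using q(1)[OF that] by (intro A_right elem_sym_power_in_subring)
    have t: "?t g \<in> ?B" if "g \<in> keys r" for g
      using r(1) that by (intro B_left perm_poly_cyclic_submodule generator_in_cyclic_submodule) auto
    have "frag_of (?s m, b) \<in> U" if m: "m \<in> keys q" for m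
    proof (rule U_cong)
      show "frag_of (?s m, b) - (\<Sum>g\<in>keys r. frag_of (?s m, ?t g)) \<in> K"
        unfolding r(2) poly_act_def by (intro kernel_sum_right s m t finite_keys)
      show "(\<Sum>g\<in>keys r. frag_of (?s m, ?t g)) \<in> U"
        using q(1)[OF m] r(1) by (intro U_sum basic) auto
    qed
    then have "(\<Sum>m\<in>keys q. frag_of (?s m, b)) \<in> U" by (intro U_sum)
    moreover have "frag_of (a, b) - (\<Sum>m\<in>keys q. frag_of (?s m, b)) \<in> K"
      unfolding q(2) elem_sym_poly_def by (intro kernel_sum_left s b finite_keys)
    ultimately show ?thesis by (rule U_cong[rotated])
  qed
  from u have "u \<in> U"
  proof (induction u rule: frag_induction)
    case (one x)
    then show ?case using pure by auto
  qed (auto simp: U_0 U_diff)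
  then show thesis using that by (auto simp: U_def)
qed

lemma rep_spans:
  assumes I: "I \<subseteq> {1..n}" and B: "B = (if n \<in> I then cyclic_submodule n (e I) else {0})"
    and u: "keys u \<subseteq> elem_sym_subring n I \<times> B"
  shows "\<exists>p. keys p \<subseteq> block I \<and> u - rep p \<in> tensor_kernel (elem_sym_subring n I) B"
proof (cases "n \<in> I")
  case True
  then have "{n} \<subseteq> I" "keys u \<subseteq> elem_sym_subring n I \<times> cyclic_submodule n (e I)"
    using B u by simp_all
  from rep_spans_cyclic[OF this(1) I this(2)] obtain p where "keys p \<subseteq> block I"
    "u - rep p \<in> tensor_kernel (elem_sym_subring n I) (cyclic_submodule n (e I))" .
  then show ?thesis using True B by auto
next
  case False
  then have B0: "B = {0}" using B by simp
  interpret tensor_pair "elem_sym_subring n I" B by (rule tensor_pair_subring) (simp add: B0)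
  \<comment> \<open>With the zero module as second factor every tensor vanishes, so the normal form
    is 0.\<close>
  from u have "u \<in> K"
  proof (induction u rule: frag_induction)
    case (one x)
    then show ?case using kernel_zero_right by (auto simp: B0)
  qed (auto simp: kernel_diff)
  then show ?thesis by (intro exI[of _ 0]) simp
qed

section \<open>The isomorphism\<close>

lemma lookup_sum_blocks:
  assumes "finite J" "\<And>I. I \<in> J \<Longrightarrow> keys (p I) \<subseteq> block I" "I \<in> J" "x \<in> block I"
  shows "lookup (\<Sum>I\<in>J. p I) x = lookup (p I) x"
proof -
  have "lookup (p I') x = 0" if "I' \<in> J - {I}" for I'
    using that assms(2)[of I'] assms(4) by (auto simp: block_def in_keys_iff)
  then show ?thesis
    unfolding sum.remove[OF assms(1,3)] lookup_add lookup_sum by (simp add: sum.neutral)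
qed

lemma sum_blocks_inject:
  assumes "finite J" "\<And>I. I \<in> J \<Longrightarrow> keys (p I) \<subseteq> block I" "\<And>I. I \<in> J \<Longrightarrow> keys (q I) \<subseteq> block I"
    and eq: "(\<Sum>I\<in>J. p I) = (\<Sum>I\<in>J. q I)" and I: "I \<in> J"
  shows "p I = q I"
proof (rule poly_mapping_eqI)
  fix x
  show "lookup (p I) x = lookup (q I) x"
  proof (cases "x \<in> block I")
    case True
    then show ?thesis
      using lookup_sum_blocks[OF assms(1,2) I True] lookup_sum_blocks[OF assms(1,3) I True] eq by simp
  next
    case False
    then have "x \<notin> keys (p I)" "x \<notin> keys (q I)" using assms(2,3) I by blast+
    then show ?thesis by (simp add: in_keys_iff)
  qed
qed

lemma sum_blocks_surj:
  assumes J: "finite J" "{I. {n} \<subseteq> I \<and> I \<subseteq> {1..n}} \<subseteq> J" and p: "p \<in> mpolys n"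
  obtains q where "\<And>I. keys (q I) \<subseteq> block I" "(\<Sum>I\<in>J. q I) = p"
proof
  let ?S = "\<lambda>I. {x \<in> keys p. supp (exps x) = I}"
  let ?q = "\<lambda>I. \<Sum>x\<in>?S I. single x (lookup p x)"
  have mon: "keys p \<subseteq> monoms n" using p by (simp add: mpolys_iff)
  show "keys (?q I) \<subseteq> block I" for I
    using mon by (intro order_trans[OF keys_sum]) (auto simp: block_def split: if_splits)
  have "(\<lambda>x. supp (exps x)) ` keys p \<subseteq> J"
  proof (rule image_subsetI)
    fix x assume "x \<in> keys p"
    then have "exps x \<in> monoms n" using mon by (intro exps_props) auto
    from supp_bounds[OF this] show "supp (exps x) \<in> J" using J(2) by auto
  qed
  then have "(\<Sum>I\<in>J. ?q I) = (\<Sum>x\<in>keys p. single x (lookup p x))"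
    using J(1) by (intro sum.group) auto
  then show "(\<Sum>I\<in>J. ?q I) = p" by (simp add: poly_mapping_sum_single)
qed

text \<open>The index family \<open>J\<close> is left open so that the sum over the sets containing
  \<open>n\<close> and the sum over all subsets, with zero modules added, are both
  instances.\<close>

lemma left_module_iso_struct_map:
  assumes J: "{I. {n} \<subseteq> I \<and> I \<subseteq> {1..n}} \<subseteq> J" "J \<subseteq> Pow {1..n}"
    and Y: "\<And>I. I \<in> J \<Longrightarrow> Y I = (if n \<in> I then cyclic_submodule n (e I) else {0})"
  shows "left_module_iso (kG n) (struct_sum n J Y) (poly_module n) (struct_map J)"
proof -
  let ?A = "elem_sym_subring n" and ?S = "struct_sum n J Y" and ?m = "struct_map J"
  let ?c = "\<lambda>I. tensor_class (?A I) (Y I)"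
  have finJ: "finite J" using J(2) finite_subset by blast
  have IJ: "I \<subseteq> {1..n}" if "I \<in> J" for I using that J(2) by blast
  have pair: "tensor_pair (?A I) (Y I)" if "I \<in> J" for I
    by (rule tensor_pair_subring[of _ "e I"]) (simp add: Y[OF that])
  note comm = tensor_pair.comm_group_tensor_module[OF pair]
  note groups = comm_group.axioms(2)[OF comm]
  let ?G = "sum_group J (\<lambda>I. add_monoid (tensor_module (?A I) (Y I)))"
  have groupG: "group ?G" using groups by simp
  have carG: "carrier ?G = (\<Pi>\<^sub>E I\<in>J. carrier (tensor_group (?A I) (Y I)))"
    using groups finJ by (subst carrier_sum_group) (auto simp: tensor_module_def)
  have S: "carrier ?S = carrier ?G" "\<zero>\<^bsub>?S\<^esub> = \<one>\<^bsub>?G\<^esub>" "\<And>f g. f \<oplus>\<^bsub>?S\<^esub> g = f \<otimes>\<^bsub>?G\<^esub> g"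
    by (simp_all add: struct_sum_def direct_sum_def)
  have abel: "abelian_group ?S"
  proof -
    interpret G: group ?G by (rule groupG)
    have "f \<otimes>\<^bsub>?G\<^esub> g = g \<otimes>\<^bsub>?G\<^esub> f" if "f \<in> carrier ?G" "g \<in> carrier ?G" for f g
      unfolding mult_sum_group
    proof (rule restrict_ext)
      fix I assume I: "I \<in> J"
      have fg: "f I \<in> carrier (tensor_group (?A I) (Y I))" "g I \<in> carrier (tensor_group (?A I) (Y I))"
        using that I unfolding carG by (blast intro: PiE_mem)+
      show "f I \<otimes>\<^bsub>add_monoid (tensor_module (?A I) (Y I))\<^esub> g I =
          g I \<otimes>\<^bsub>add_monoid (tensor_module (?A I) (Y I))\<^esub> f I"
        by (rule comm_monoid.m_comm[OF comm_group.axioms(1)[OF comm[OF I]]])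
          (use fg in \<open>simp_all add: tensor_module_def\<close>)
    qed
    moreover have "\<exists>g\<in>carrier ?G. g \<otimes>\<^bsub>?G\<^esub> f = \<one>\<^bsub>?G\<^esub>" if "f \<in> carrier ?G" for f
      by (rule G.l_inv_ex[OF that])
    ultimately show ?thesis
      by (intro abelian_groupI, unfold S) (rule G.m_closed G.one_closed G.m_assoc G.l_one | assumption | blast)+
  qed
  have classes: "\<exists>u. \<forall>I\<in>J. keys (u I) \<subseteq> ?A I \<times> Y I \<and> f I = ?c I (u I)" if f: "f \<in> carrier ?S" for f
  proof (rule bchoice, rule ballI)
    fix I assume "I \<in> J"
    then have "f I \<in> carrier (tensor_group (?A I) (Y I))" using f by (auto simp: S carG)
    then show "\<exists>u. keys u \<subseteq> ?A I \<times> Y I \<and> f I = ?c I u"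
      by (auto simp: tensor_pair.carrier_tensor_group[OF pair[OF \<open>I \<in> J\<close>]])
  qed
  have in_carrier: "(\<lambda>I\<in>J. ?c I (u I)) \<in> carrier ?S" if "\<And>I. I \<in> J \<Longrightarrow> keys (u I) \<subseteq> ?A I \<times> Y I" for u
    using that by (auto simp: S carG tensor_pair.tensor_class_in_carrier[OF pair])
  have map_class: "?m f = (\<Sum>I\<in>J. eval_product (u I))" if "\<And>I. I \<in> J \<Longrightarrow> f I = ?c I (u I)" for f u
    unfolding struct_map_def
    by (intro sum.cong refl) (simp add: that mult_map_class[OF tensor_pair.relations[OF pair]])
  have normal_form: "\<exists>p. \<forall>I\<in>J. keys (p I) \<subseteq> block I \<and> f I = ?c I (rep (p I))" if f: "f \<in> carrier ?S" for f
  proof (rule bchoice, rule ballI)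
    fix I assume I: "I \<in> J"
    obtain u where u: "keys (u I) \<subseteq> ?A I \<times> Y I" "f I = ?c I (u I)" using classes[OF f] I by blast
    obtain p where "keys p \<subseteq> block I" "u I - rep p \<in> tensor_kernel (?A I) (Y I)"
      using rep_spans[OF IJ[OF I] Y[OF I] u(1)] by blast
    then show "\<exists>p. keys p \<subseteq> block I \<and> f I = ?c I (rep p)"
      using tensor_pair.tensor_class_eqI[OF pair[OF I]] u(2) by auto
  qed
  have map_rep: "?m f = expand (\<Sum>I\<in>J. p I)" if "\<And>I. I \<in> J \<Longrightarrow> f I = ?c I (rep (p I))" for f p
    using map_class[OF that] by (simp add: eval_product_rep expand_sum)
  have blocks_mpolys: "(\<Sum>I\<in>J. p I) \<in> mpolys n" if "\<And>I. I \<in> J \<Longrightarrow> keys (p I) \<subseteq> block I" for p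
    using that by (intro mpolys_sum) (auto simp: mpolys_iff block_def)
  \<comment> \<open>Normal forms map to values of \<open>expand\<close>. Its injectivity identifies
    the two sums, and disjointness of the blocks then recovers every component.\<close>
  have inj: "f = g" if fg: "f \<in> carrier ?S" "g \<in> carrier ?S" "?m f = ?m g" for f g
  proof -
    obtain p q where p: "\<And>I. I \<in> J \<Longrightarrow> keys (p I) \<subseteq> block I" "\<And>I. I \<in> J \<Longrightarrow> f I = ?c I (rep (p I))"
      and q: "\<And>I. I \<in> J \<Longrightarrow> keys (q I) \<subseteq> block I" "\<And>I. I \<in> J \<Longrightarrow> g I = ?c I (rep (q I))"
      using normal_form[OF fg(1)] normal_form[OF fg(2)] by metis
    let ?p = "\<Sum>I\<in>J. p I" and ?q = "\<Sum>I\<in>J. q I"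
    have "expand ?p = expand ?q" using fg(3) map_rep[OF p(2)] map_rep[OF q(2)] by simp
    then have 0: "expand (?p - ?q) = 0" using expand_add[of "?p - ?q" ?q] by simp
    have "?p \<in> mpolys n" "?q \<in> mpolys n" using blocks_mpolys p(1) q(1) by blast+
    from expand_eq_0[OF mpolys_diff[OF this] 0] have "?p = ?q" by simp
    then have "f I = g I" if "I \<in> J" for I
      using sum_blocks_inject[of J p q I] finJ p q that by simp
    then show "f = g" using fg by (auto simp: S carG intro: PiE_ext)
  qed
  have surj: "\<exists>f\<in>carrier ?S. ?m f = v" if v: "v \<in> mpolys n" for v
  proof -
    obtain p where p: "p \<in> mpolys n" "expand p = v" using expand_surj[OF v] .
    obtain q where q: "\<And>I. keys (q I) \<subseteq> block I" "(\<Sum>I\<in>J. q I) = p"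
      using sum_blocks_surj[OF finJ J(1) p(1)] by metis
    let ?f = "\<lambda>I\<in>J. ?c I (rep (q I))"
    have "?f \<in> carrier ?S" by (intro in_carrier keys_rep q(1)) (simp add: Y)
    moreover have "?m ?f = v" using map_rep[of ?f q] by (simp add: q(2) p(2))
    ultimately show ?thesis by blast
  qed
  have eval_in_mpolys: "eval_product u \<in> mpolys n" if I: "I \<in> J" and u: "keys u \<subseteq> ?A I \<times> Y I" for I u
    unfolding eval_product_def
  proof (rule mpolys_sum)
    fix x assume "x \<in> keys u"
    then obtain a b where x: "x = (a, b)" "a \<in> ?A I" "b \<in> Y I" using u by blast
    have "a \<in> mpolys n" using elem_sym_subring_in_mpolys[OF IJ[OF I] x(2)] .
    moreover have "b \<in> mpolys n"
      using x(3) Y[OF I] e_in_mpolys[of I] IJ[OF I] cyclic_submodule_in_mpolys[of "e I" n b]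
      by (auto split: if_splits)
    moreover have "(of_int k :: 'k mpoly) \<in> mpolys n" for k
      by (simp add: mpolys_def flip: single_of_int)
    ultimately show "(case x of (a, b) \<Rightarrow> of_int (lookup u (a, b)) * (a * b)) \<in> mpolys n"
      by (simp add: x mpolys_mult)
  qed
  have map_closed: "?m f \<in> mpolys n" if f: "f \<in> carrier ?S" for f
  proof -
    obtain u where "\<forall>I\<in>J. keys (u I) \<subseteq> ?A I \<times> Y I \<and> f I = ?c I (u I)" using classes[OF f] by blast
    then show ?thesis by (simp add: map_class[of f u] eval_in_mpolys mpolys_sum)
  qed
  have map_add: "?m (f \<oplus>\<^bsub>?S\<^esub> g) = ?m f + ?m g" if fg: "f \<in> carrier ?S" "g \<in> carrier ?S" for f g
  proof -
    obtain u v where u: "\<And>I. I \<in> J \<Longrightarrow> keys (u I) \<subseteq> ?A I \<times> Y I" "\<And>I. I \<in> J \<Longrightarrow> f I = ?c I (u I)"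
      and v: "\<And>I. I \<in> J \<Longrightarrow> keys (v I) \<subseteq> ?A I \<times> Y I" "\<And>I. I \<in> J \<Longrightarrow> g I = ?c I (v I)"
      using classes[OF fg(1)] classes[OF fg(2)] by metis
    have "(f \<oplus>\<^bsub>?S\<^esub> g) I = ?c I (u I + v I)" if "I \<in> J" for I
      using tensor_pair.tensor_group_mult[OF pair[OF that] u(1)[OF that] v(1)[OF that]] that
      by (simp add: S u v tensor_module_def)
    then have "?m (f \<oplus>\<^bsub>?S\<^esub> g) = (\<Sum>I\<in>J. eval_product (u I + v I))" by (rule map_class)
    then show ?thesis
      by (simp add: map_class[OF u(2)] map_class[OF v(2)] eval_product_add sum.distrib)
  qed
  have smult: "r \<odot>\<^bsub>?S\<^esub> f \<in> carrier ?S \<and> ?m (r \<odot>\<^bsub>?S\<^esub> f) = poly_act r (?m f)"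
    if f: "f \<in> carrier ?S" and r: "keys r \<subseteq> carrier (sym_group n)" for r f
  proof -
    obtain u where u: "\<And>I. I \<in> J \<Longrightarrow> keys (u I) \<subseteq> ?A I \<times> Y I" "\<And>I. I \<in> J \<Longrightarrow> f I = ?c I (u I)"
      using classes[OF f] by metis
    have Y_perm: "perm_poly g b \<in> Y I" if "I \<in> J" "b \<in> Y I" "g \<in> keys r" for I b g
      using that Y[OF that(1)] r perm_poly_cyclic_submodule[of b n "e I" g] by (auto split: if_splits)
    have "r \<odot>\<^bsub>tensor_module (?A I) (Y I)\<^esub> f I = ?c I (tensor_act r (u I))" if "I \<in> J" for I
      unfolding u(2)[OF that]
      by (intro tensor_smult_class tensor_pair.relations elem_sym_subring_intros pair that Y_perm)
    then have eq: "r \<odot>\<^bsub>?S\<^esub> f = (\<lambda>I\<in>J. ?c I (tensor_act r (u I)))"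
      by (simp add: struct_sum_def direct_sum_def cong: restrict_cong)
    have "r \<odot>\<^bsub>?S\<^esub> f \<in> carrier ?S"
      unfolding eq using u(1) by (intro in_carrier tensor_pair.keys_tensor_act pair Y_perm)
    moreover have "?m (r \<odot>\<^bsub>?S\<^esub> f) = (\<Sum>I\<in>J. eval_product (tensor_act r (u I)))"
      unfolding eq by (rule map_class) simp
    moreover have "\<dots> = (\<Sum>I\<in>J. poly_act r (eval_product (u I)))"
    proof (rule sum.cong[OF refl])
      fix I assume I: "I \<in> J"
      show "eval_product (tensor_act r (u I)) = poly_act r (eval_product (u I))"
        by (rule tensor_pair.eval_product_tensor_act[OF pair[OF I] u(1)[OF I]])
          (use r perm_elem_sym_subring[OF IJ[OF I]] in auto)
    qed
    moreover have "\<dots> = poly_act r (?m f)"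
      using map_class[of f u, OF u(2)] by (simp add: poly_act_sum)
    ultimately show ?thesis by simp
  qed
  interpret S: abelian_group ?S by (rule abel)
  interpret N: left_module "kG n :: ((nat \<Rightarrow> nat) \<Rightarrow>\<^sub>0 'k) ring" "poly_module n" by (rule left_module_poly_module)
  \<comment> \<open>The map \<open>?m\<close> is injective, additive and compatible with the action,
    so each axiom follows from the corresponding one in \<open>poly_module n\<close>.\<close>
  have modS: "left_module (kG n) ?S"
  proof
    fix r s :: "(nat \<Rightarrow> nat) \<Rightarrow>\<^sub>0 'k" and f g
    assume rs: "r \<in> carrier (kG n)" "s \<in> carrier (kG n)" and f: "f \<in> carrier ?S" and g: "g \<in> carrier ?S"
    note facts = smult map_add f g S.a_closed
    show "(r \<oplus>\<^bsub>kG n\<^esub> s) \<odot>\<^bsub>?S\<^esub> f = r \<odot>\<^bsub>?S\<^esub> f \<oplus>\<^bsub>?S\<^esub> s \<odot>\<^bsub>?S\<^esub> f"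
      using rs N.R.a_closed[OF rs]
      by (intro inj) (simp_all add: facts poly_act_add_left del: carrier_sym_group)
    show "r \<odot>\<^bsub>?S\<^esub> (f \<oplus>\<^bsub>?S\<^esub> g) = r \<odot>\<^bsub>?S\<^esub> f \<oplus>\<^bsub>?S\<^esub> r \<odot>\<^bsub>?S\<^esub> g"
      using rs by (intro inj) (simp_all add: facts poly_act_add_right del: carrier_sym_group)
    show "(r \<otimes>\<^bsub>kG n\<^esub> s) \<odot>\<^bsub>?S\<^esub> f = r \<odot>\<^bsub>?S\<^esub> (s \<odot>\<^bsub>?S\<^esub> f)"
      using rs N.R.m_closed[OF rs]
      by (intro inj) (simp_all add: facts poly_act_mult del: carrier_sym_group)
    show "r \<odot>\<^bsub>?S\<^esub> f \<in> carrier ?S" using rs f smult by simp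
  next
    fix f assume f: "f \<in> carrier ?S"
    show "\<one>\<^bsub>kG n\<^esub> \<odot>\<^bsub>?S\<^esub> f = f"
      using N.R.one_closed f smult[OF f, of "\<one>\<^bsub>kG n\<^esub>"]
      by (intro inj) (simp_all add: sym_group_one)
  qed
  have "inj_on ?m (carrier ?S)" by (rule inj_onI) (rule inj)
  moreover have "?m ` carrier ?S = mpolys n" using map_closed surj by fast
  ultimately have "?m \<in> iso (add_monoid ?S) (add_monoid (poly_module n))"
    using map_closed map_add by (simp add: iso_def hom_def bij_betw_def)
  then show ?thesis
    unfolding left_module_iso_def
    using modS N.left_module_axioms smult by simp
qed

end

theorem theorem5p2:
  fixes n :: nat
    and e :: "nat set \<Rightarrow> 'k::ring_1_no_zero_divisors mpoly"
  assumes "n \<ge> 1"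
    and "\<And>I. {n} \<subseteq> I \<Longrightarrow> I \<subseteq> {1..n} \<Longrightarrow> e I \<in> mpolys n"
    and "\<And>I. {n} \<subseteq> I \<Longrightarrow> I \<subseteq> {1..n} \<Longrightarrow> G_lm n (e I) = {top_monom TYPE('k) n I}"
    and "\<And>I. {n} \<subseteq> I \<Longrightarrow> I \<subseteq> {1..n} \<Longrightarrow> stab_poly n (e I) = stab_monom n (lm_lex (e I))"
    and "\<And>I. {n} \<subseteq> I \<Longrightarrow> I \<subseteq> {1..n} \<Longrightarrow>
           two_sided_unit (Poly_Mapping.lookup (e I) (top_monom TYPE('k) n I))"
  shows "left_module_iso (kG n) (struct_sum n {I. {n} \<subseteq> I \<and> I \<subseteq> {1..n}}
             (\<lambda>I. cyclic_submodule n (e I))) (poly_module n)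
           (struct_map {I. {n} \<subseteq> I \<and> I \<subseteq> {1..n}})
       \<and> structure_theorem n (\<lambda>I. if n \<in> I then cyclic_submodule n (e I) else {0})"
proof
  interpret leading_generators n e by unfold_locales fact+
  show "left_module_iso (kG n) (struct_sum n {I. {n} \<subseteq> I \<and> I \<subseteq> {1..n}}
             (\<lambda>I. cyclic_submodule n (e I))) (poly_module n)
           (struct_map {I. {n} \<subseteq> I \<and> I \<subseteq> {1..n}})"
    by (rule left_module_iso_struct_map) auto
  show "structure_theorem n (\<lambda>I. if n \<in> I then cyclic_submodule n (e I) else {0})"
    unfolding structure_theorem_def
  proof (intro conjI allI impI left_module_iso_struct_map)
    fix I assume I: "I \<subseteq> {1..n}"
    show "fin_gen_submodule (kG n) (poly_module n) (if n \<in> I then cyclic_submodule n (e I) else {0})"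
      using e_in_mpolys[OF _ I] fin_gen_cyclic_submodule[of "e I" n] fin_gen_zero_submodule[of n, where 'k = 'k] by simp
  qed auto
qed

end
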